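(* Let $\alpha,\beta>-1$. For $n=0,1,\dots$, the $(n+1)\times(n+1)$ matrix $$\left({}_{2}F_{1}\left(-i-j,\ \beta+1;\ \alpha+\beta+1;\ 2\right)\right)_{0\le i,j\le n}$$ has the determinant $$\begin{aligned} \det\left({}_{2}F_{1}\left(-i-j,\beta+1;\alpha+\beta+1;2\right)\right)_{i,j=0}^{n} ={}&\left(\frac{\Gamma(\alpha+\beta+1)\,2^{-(2\alpha+2\beta+n+1)}\,\pi}{\Gamma(\alpha+1)\,\Gamma(\beta+1)}\right)^{n+1}\\ &\times\frac{G(n+2)\,G\left(\frac{\alpha+\beta+1}{2}\right)^{2}G\left(\frac{\alpha+\beta+2}{2}\right)^{2}}{G\left(\frac{\alpha+\beta+3}{2}+n\right)^{2}G\left(\frac{\alpha+\beta+4}{2}+n\right)^{2}}\\ &\times\frac{G(\alpha+\beta+n+2)\,G(\alpha+n+2)\,G(\beta+n+2)}{\left(\frac{\alpha+\beta+1}{2}\right)_{n+1}G(\alpha+\beta+1)\,G(\alpha+1)\,G(\beta+1)}, \end{aligned}$$ and its inverse matrix $(\beta_{ij})_{0\le i,j\le n}$ has entries $$\begin{aligned} \beta_{ij}={}&\sum_{k=\max(i,j)}^{n}\frac{k!\,(2k+\alpha+\beta+1)\,(\alpha+\beta+1)_{k}}{(-2)^{i+j}\,i!\,j!\,(\alpha+1)_{k}(\beta+1)_{k}}\\ &\times (k+\alpha+\beta+1)_{i}\,P_{k-i}^{(\alpha+i,\beta+i)}(0)\,(k+\alpha+\beta+1)_{j}\,P_{k-j}^{(\alpha+j,\beta+j)}(0)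 \end{aligned}$$ for $i,j=0,1,\dots,n$.
   Context: $\Gamma$ is Euler's gamma function, $(a)_n=\Gamma(a+n)/\Gamma(a)$ is the shifted factorial, and ${}_2F_1(a,b;c;z)=\sum_{m\ge0}\frac{(a)_m(b)_m}{(c)_m}\frac{z^m}{m!}$ (a finite sum when $a=-i-j$ is a nonpositive integer, with $(-N)_m=(-N)(-N+1)\cdots(-N+m-1)$). $P_n^{(\alpha,\beta)}$ ($n\ge0$) are the Jacobi polynomials $P_n^{(\alpha,\beta)}(x)=\frac{(\alpha+1)_n}{n!}\,{}_2F_1\left(-n,n+\alpha+\beta+1;\alpha+1;\tfrac{1-x}{2}\right)$. $G$ is the Barnes $G$-function, the entire function given by $G(z+1)=(2\pi)^{z/2}e^{-[z(z+1)+\gamma z^2]/2}\prod_{m=1}^{\infty}\left(1+\frac zm\right)^m e^{-z+z^2/(2m)}$ with $\gamma$ Euler's constant; it satisfies $G(z+1)=\Gamma(z)G(z)$ and $G(1)=1$.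
   Formalization: As printed it fails (n=0, α=β=1: det 1, not 1/3). Proved with third 2F1 parameter α+β+2, with Γ(α+β+2) for Γ(α+β+1) in the determinant, with (α+β+1)_k divided by α+β+1 in β_ij, and for α+β+1≠0, where the printed formulas are defined. *)

theory Defs
  imports
    "HOL-Analysis.Gamma_Function"
    "HOL-Analysis.Infinite_Products"
    "Jordan_Normal_Form.Determinant"
begin

text \<open>
  The source has the third parameter \<open>\<alpha> + \<beta> + 1\<close> in the hypergeometric
  function, \<open>\<Gamma>(\<alpha> + \<beta> + 1)\<close> in the determinant, and no division by
  \<open>\<alpha> + \<beta> + 1\<close> in the entries of the inverse.  In that form the claim is false: for
  \<open>n = 0\<close>, \<open>\<alpha> = \<beta> = 1\<close> the matrix is \<open>(1)\<close>, but the printed determinant is \<open>1/3\<close>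
  and the printed entry of the inverse is \<open>3\<close>.  All three places use the value
  \<open>\<Gamma>(\<alpha> + 1) \<Gamma>(\<beta> + 1) / \<Gamma>(\<alpha> + \<beta> + 1)\<close> for the beta integral; the theorem
  is stated with the correct denominator \<open>\<Gamma>(\<alpha> + \<beta> + 2)\<close> in all three.
  The case \<open>\<alpha> + \<beta> + 1 = 0\<close> is excluded, since there \<open>\<Gamma>(\<alpha> + \<beta> + 1)\<close> has a pole and
  \<open>G(\<alpha> + \<beta> + 1)\<close> vanishes in a denominator.
\<close>

definition hyp2F1 :: "real \<Rightarrow> real \<Rightarrow> real \<Rightarrow> real \<Rightarrow> real" where
  "hyp2F1 a b c z =
     (\<Sum>m. pochhammer a m * pochhammer b m / pochhammer c m * z ^ m / fact m)"

definition jacobi_P :: "nat \<Rightarrow> real \<Rightarrow> real \<Rightarrow> real \<Rightarrow> real" where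
  "jacobi_P n \<alpha> \<beta> x =
     pochhammer (\<alpha> + 1) n / fact n *
       hyp2F1 (- real n) (real n + \<alpha> + \<beta> + 1) (\<alpha> + 1) ((1 - x) / 2)"

text \<open>
  The product formula of the Barnes function is for \<open>G(w + 1)\<close>, hence \<open>w = z - 1\<close>, and
  the factors are indexed from \<open>0\<close>.  The power \<open>(2\<pi>)^(w/2)\<close> is written with the
  exponential so that the definition covers both the entire function (type
  \<^typ>\<open>complex\<close>) and its restriction to the real line.
\<close>

definition barnes_G :: "'a :: {banach, real_normed_field} \<Rightarrow> 'a" where
  "barnes_G z = (let w = z - 1 in
     exp (w / 2 * of_real (ln (2 * pi)))
     * exp (- (w * (w + 1) + euler_mascheroni * w ^ 2) / 2)
     * (\<Prod>m. (1 + w / of_nat (Suc m)) ^ Suc m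
               * exp (- w + w ^ 2 / (2 * of_nat (Suc m)))))"

end

theory Submission
  imports Defs "HOL-Real_Asymp.Real_Asymp" "HOL-Computational_Algebra.Formal_Power_Series"
begin

text \<open>
  The matrix entries are the moments \<open>L ((2 u - 1) ^ (i + j))\<close> of the linear functional with
  \<open>L (u ^ m) = (\<alpha> + 1)\<^sub>m / (\<alpha> + \<beta> + 2)\<^sub>m\<close> (a normalised beta integral, never used as such).
  The Jacobi polynomials are orthogonal for \<open>L\<close>, because \<open>L (u ^ j * P\<^sub>k)\<close> is a \<open>k\<close>-th
  finite difference of a polynomial of degree less than \<open>k\<close> when \<open>j < k\<close>.  Hence, if \<open>D\<close> is
  the lower triangular matrix of the coefficients of \<open>P\<^sub>k\<close> in powers of \<open>2 u - 1\<close>, then \<open>D A D\<^sup>T\<close>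
  is diagonal, which gives both the inverse and the determinant as a product.  The ratio of
  the closed forms for consecutive sizes is evaluated with \<open>G (z + 1) = \<Gamma>(z) G(z)\<close> and the
  Legendre duplication formula.  The functional equation of \<open>G\<close> holds up to a constant by
  telescoping the partial products; the constant is Stirling's.
\<close>

section \<open>The Barnes function on the real line\<close>

definition barnes_factor :: "real \<Rightarrow> nat \<Rightarrow> real" where
  "barnes_factor z m =
     (1 + z / real (Suc m)) ^ Suc m * exp (- z + z ^ 2 / (2 * real (Suc m)))"

text \<open>With x = z / (m + 1), the correction terms cancel the Taylor polynomial of ln (1 + x) up
  to second order. The remainder is of order x^3, and the exponent m + 1 costs one power of
  m.\<close>

lemma log_barnes_factor_bigo:
  "(\<lambda>m. real (Suc m) * ln (1 + z / real (Suc m)) - z + z ^ 2 / (2 * real (Suc m))) \<in> O(\<lambda>m. 1 / real m ^ 2)"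
proof -
  have "(\<lambda>x::real. ln (1 + x) - x + x ^ 2 / 2) \<in> O[at_right 0](\<lambda>x. x ^ 3)"
       "(\<lambda>x::real. ln (1 + x) - x + x ^ 2 / 2) \<in> O[at_left 0](\<lambda>x. x ^ 3)"
    by real_asymp+
  hence "(\<lambda>x::real. ln (1 + x) - x + x ^ 2 / 2) \<in> O[at 0](\<lambda>x. x ^ 3)"
    by (simp add: at_eq_sup_left_right landau_o.big.sup)
  \<comment> \<open>For z = 0 the argument z / (m + 1) is constantly 0, a point that
    \<open>at 0\<close> leaves out; hence the passage to \<open>nhds 0\<close> before
    composing.\<close>
  hence "(\<lambda>x::real. ln (1 + x) - x + x ^ 2 / 2) \<in> O[nhds 0](\<lambda>x. x ^ 3)"
    by (auto elim!: landau_o.bigE intro!: landau_o.bigI simp: eventually_nhds_conv_at)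
  moreover have lim: "filterlim (\<lambda>m. z / real (Suc m)) (nhds 0) sequentially"
    by real_asymp
  ultimately have "(\<lambda>m. ln (1 + z / real (Suc m)) - z / real (Suc m) + (z / real (Suc m)) ^ 2 / 2)
      \<in> O(\<lambda>m. (z / real (Suc m)) ^ 3)"
    by (rule landau_o.big.compose)
  hence "(\<lambda>m. real (Suc m) * (ln (1 + z / real (Suc m)) - z / real (Suc m) + (z / real (Suc m)) ^ 2 / 2))
      \<in> O(\<lambda>m. real (Suc m) * (z / real (Suc m)) ^ 3)"
    by (rule landau_o.big.mult_left)
  also have "(\<lambda>m. real (Suc m) * (z / real (Suc m)) ^ 3) = (\<lambda>m. z ^ 3 * (1 / real (Suc m) ^ 2))"
    by (intro ext) (simp add: power_divide power2_eq_square power3_eq_cube del: of_nat_Suc)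
  also have "(\<lambda>m. z ^ 3 * (1 / real (Suc m) ^ 2)) \<in> O(\<lambda>m. 1 / real (Suc m) ^ 2)"
    by (rule landau_o.bigI[of "\<bar>z ^ 3\<bar> + 1"]) (auto simp: abs_mult intro!: always_eventually divide_right_mono)
  also have "(\<lambda>m. 1 / real (Suc m) ^ 2) \<in> O(\<lambda>m. 1 / real m ^ 2)"
    by real_asymp
  also have "(\<lambda>m. real (Suc m) * (ln (1 + z / real (Suc m)) - z / real (Suc m) + (z / real (Suc m)) ^ 2 / 2))
    = (\<lambda>m. real (Suc m) * ln (1 + z / real (Suc m)) - z + z ^ 2 / (2 * real (Suc m)))"
    by (intro ext) (simp add: algebra_simps power_divide power2_eq_square del: of_nat_Suc)
  finally show ?thesis .
qed

text \<open>Follows from the bound on the logarithm, because exp x - 1 = O(x) near 0.\<close>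

lemma barnes_factor_bigo: "(\<lambda>m. barnes_factor z m - 1) \<in> O(\<lambda>m. 1 / real m ^ 2)"
proof -
  let ?l = "\<lambda>m. real (Suc m) * ln (1 + z / real (Suc m)) - z + z ^ 2 / (2 * real (Suc m))"
  have "(\<lambda>m. 1 / real m ^ 2) \<in> o(\<lambda>_. 1)"
    by real_asymp
  with log_barnes_factor_bigo have "?l \<in> o(\<lambda>_. 1)"
    by (rule landau_o.big_small_trans)
  hence "?l \<longlonglongrightarrow> 0"
    by (drule_tac smalloD_tendsto) simp
  have "(\<lambda>x::real. exp x - 1) \<in> O[at_right 0](\<lambda>x. x)"
       "(\<lambda>x::real. exp x - 1) \<in> O[at_left 0](\<lambda>x. x)"
    by real_asymp+
  hence "(\<lambda>x::real. exp x - 1) \<in> O[at 0](\<lambda>x. x)"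
    by (simp add: at_eq_sup_left_right landau_o.big.sup)
  hence "(\<lambda>x::real. exp x - 1) \<in> O[nhds 0](\<lambda>x. x)"
    by (auto elim!: landau_o.bigE intro!: landau_o.bigI simp: eventually_nhds_conv_at)
  from landau_o.big.compose[OF this \<open>?l \<longlonglongrightarrow> 0\<close>]
  have "(\<lambda>m. exp (?l m) - 1) \<in> O(?l)" .
  also note log_barnes_factor_bigo
  \<comment> \<open>For negative z the first few bases 1 + z / (m + 1) may be nonpositive, so the
    factor is the exponential of its logarithm only for large m.\<close>
  also have "eventually (\<lambda>m. 1 + z / real (Suc m) > 0) sequentially"
    by real_asymp
  hence "eventually (\<lambda>m. exp (?l m) - 1 = barnes_factor z m - 1) sequentially"
  proof eventually_elim
    case (elim m)
    hence "exp (real (Suc m) * ln (1 + z / real (Suc m))) = (1 + z / real (Suc m)) ^ Suc m"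
      by (simp only: exp_of_nat_mult exp_ln)
    moreover have "?l m = real (Suc m) * ln (1 + z / real (Suc m)) + (- z + z ^ 2 / (2 * real (Suc m)))"
      by simp
    ultimately show ?case
      by (simp only: barnes_factor_def exp_add)
  qed
  hence "((\<lambda>m. exp (?l m) - 1) \<in> O(\<lambda>m. 1 / real m ^ 2)) \<longleftrightarrow> ?thesis"
    by (rule landau_o.big.in_cong)
  finally show ?thesis .
qed

lemma convergent_prod_barnes_factor: "convergent_prod (barnes_factor z)"
proof -
  have "summable (\<lambda>m. 1 / real m ^ 2)"
    using inverse_power_summable[of 2, where 'a = real] by (simp add: inverse_eq_divide)
  hence "summable (\<lambda>m. norm (1 / real m ^ 2))"
    by (simp only: norm_divide norm_power norm_of_nat norm_one)
  moreover have "(\<lambda>m. norm (barnes_factor z m - 1)) \<in> O(\<lambda>m. 1 / real m ^ 2)"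
    using barnes_factor_bigo unfolding real_norm_def landau_o.big.abs_in_iff .
  ultimately have "summable (\<lambda>m. norm (barnes_factor z m - 1))"
    by (rule summable_comparison_test_bigo)
  hence "abs_convergent_prod (barnes_factor z)"
    by (rule summable_imp_abs_convergent_prod)
  thus ?thesis
    by (rule abs_convergent_prod_imp_convergent_prod)
qed

definition barnes_partial :: "real \<Rightarrow> nat \<Rightarrow> real" where
  "barnes_partial z N = (\<Prod>m<N. barnes_factor z m)"

lemma barnes_partial_LIMSEQ: "barnes_partial z \<longlonglongrightarrow> (\<Prod>m. barnes_factor z m)"
  using convergent_prod_LIMSEQ[OF convergent_prod_barnes_factor[of z]]
  unfolding barnes_partial_def by (simp add: LIMSEQ_lessThan_iff_atMost)

text \<open>The factor with index m vanishes only at z = -(m + 1), that is, at z + 1 = -m.\<close>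

lemma barnes_factor_nonzero: "z + 1 \<notin> \<int>\<^sub>\<le>\<^sub>0 \<Longrightarrow> barnes_factor z m \<noteq> 0"
proof
  assume "z + 1 \<notin> \<int>\<^sub>\<le>\<^sub>0" "barnes_factor z m = 0"
  hence "1 + z / real (Suc m) = 0"
    by (simp add: barnes_factor_def del: power_Suc of_nat_Suc)
  hence "z + 1 = - real m"
    by (simp add: field_simps)
  thus False using \<open>z + 1 \<notin> \<int>\<^sub>\<le>\<^sub>0\<close> by simp
qed

lemma prodinf_barnes_factor_nonzero: "z + 1 \<notin> \<int>\<^sub>\<le>\<^sub>0 \<Longrightarrow> (\<Prod>m. barnes_factor z m) \<noteq> 0"
  by (intro prodinf_nonzero convergent_prod_barnes_factor barnes_factor_nonzero)

section \<open>Telescoping of the partial products\<close>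

text \<open>An exact form of the functional equation for finite products. With x = N + 1 it rests on
  (1 + z / x) (z + N) = (1 + (z - 1) / x) (z + x), raised to the power N + 1; the differences of the
  exponential corrections add up to the harmonic number.\<close>

lemma barnes_partial_shift:
  "barnes_partial z N * pochhammer z N =
     barnes_partial (z - 1) N * ((z + real N) ^ N * exp (- real N + (z - 1 / 2) * harm N))"
proof (induction N)
  case (Suc N)
  define x where "x = real (Suc N)"
  have x: "x \<noteq> 0" "real N = x - 1" by (auto simp: x_def)
  have *: "- z + z\<^sup>2 / (2 * real (Suc N)) =
        (- (z - 1) + (z - 1)\<^sup>2 / (2 * real (Suc N))) + (- 1 + (z - 1 / 2) / real (Suc N))"
    unfolding x_def[symmetric] using x by (simp add: field_simps power2_eq_square)
  have "(1 + z / x) * (z + real N) = (1 + (z - 1) / x) * (z + x)"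
    unfolding x(2) using x(1) by (simp add: field_simps)
  hence **: "(1 + z / x) ^ Suc N * (z + real N) ^ Suc N = (1 + (z - 1) / x) ^ Suc N * (z + x) ^ Suc N"
    by (simp only: flip: power_mult_distrib)
  have step: "barnes_factor z N * (z + real N) ^ Suc N =
      barnes_factor (z - 1) N * ((z + real (Suc N)) ^ Suc N * exp (- 1 + (z - 1 / 2) / real (Suc N)))"
    unfolding barnes_factor_def * exp_add using ** unfolding x_def[symmetric]
    by (simp add: mult_ac del: power_Suc)
  let ?E = "exp (- real N + (z - 1 / 2) * harm N)"
  have "barnes_partial z (Suc N) * pochhammer z (Suc N) =
      (barnes_partial z N * pochhammer z N) * (barnes_factor z N * (z + real N))"
    by (simp add: barnes_partial_def pochhammer_Suc)
  \<comment> \<open>The power (z + N)^N from the induction hypothesis and the new Pochhammer factor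
    z + N combine to the exponent N + 1 that \<open>step\<close> requires.\<close>
  also have "\<dots> = barnes_partial (z - 1) N * ?E * (barnes_factor z N * (z + real N) ^ Suc N)"
    unfolding Suc.IH power_Suc by (simp only: mult_ac)
  also have "\<dots> = barnes_partial (z - 1) (Suc N) * ((z + real (Suc N)) ^ Suc N *
        (?E * exp (- 1 + (z - 1 / 2) / real (Suc N))))"
    unfolding step by (simp add: barnes_partial_def del: power_Suc of_nat_Suc)
  also have "exp (- real N + (z - 1 / 2) * harm N) * exp (- 1 + (z - 1 / 2) / real (Suc N)) =
      exp (- real (Suc N) + (z - 1 / 2) * harm (Suc N))"
    unfolding exp_add[symmetric]
    by (rule arg_cong[where f = exp]) (simp add: harm_Suc inverse_eq_divide algebra_simps add_divide_distrib diff_divide_distrib)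
  finally show ?case .
qed (simp add: barnes_partial_def harm_def)

definition stirling_ratio :: "nat \<Rightarrow> real" where
  "stirling_ratio N = fact N * exp (real N) / (real N ^ N * sqrt (real N))"

text \<open>Rearranges the shift identity so that every factor on the right has a known limit:
  \<open>Gamma_series'\<close> tends to Gamma, (1 + z / N)^N to exp z, and harm N - ln N to Euler's
  constant. What is left over does not depend on z and is \<open>stirling_ratio\<close>.\<close>

lemma barnes_partial_shift_stirling:
  assumes "z \<notin> \<int>\<^sub>\<le>\<^sub>0" "N > 0"
  shows "barnes_partial z N * stirling_ratio N = barnes_partial (z - 1) N * (Gamma_series' z N *
     ((z + real N) / real N) ^ N * exp ((z - 1 / 2) * (harm N - ln (real N))))"
proof -
  have nz: "pochhammer z N \<noteq> 0"
    using assms by (auto simp: pochhammer_eq_0_iff)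
  have f: "fact N = real N * fact (N - 1)"
    using assms by (simp add: fact_reduce)
  \<comment> \<open>The powers N^z and N^(-(z - 1/2)) leave N^(1/2), which accounts for the square
    root in \<open>stirling_ratio\<close>.\<close>
  have e: "exp (z * ln (real N)) * exp ((z - 1 / 2) * (harm N - ln (real N)))
     = exp ((z - 1 / 2) * harm N) * sqrt (real N)"
    using assms by (simp add: powr_half_sqrt [symmetric] powr_def flip: exp_add) (simp add: algebra_simps)
  have "barnes_partial z N * stirling_ratio N =
    barnes_partial z N * pochhammer z N * (stirling_ratio N / pochhammer z N)"
    using nz by simp
  also have "\<dots> = barnes_partial (z - 1) N *
     ((z + real N) ^ N * exp (- real N) * exp ((z - 1 / 2) * harm N) * stirling_ratio N / pochhammer z N)"
    unfolding barnes_partial_shift exp_add by simp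
  also have "(z + real N) ^ N * exp (- real N) * exp ((z - 1 / 2) * harm N) * stirling_ratio N / pochhammer z N =
     fact (N - 1) * ((z + real N) / real N) ^ N * (exp ((z - 1 / 2) * harm N) * sqrt (real N)) / pochhammer z N"
  proof -
    have 1: "exp (- real N) * exp (real N) = 1" by (simp flip: exp_add)
    have 2: "real N / sqrt (real N) = sqrt (real N)"
      by (rule real_div_sqrt) simp
    have 3: "(z + real N) ^ N * exp (- real N) * exp ((z - 1 / 2) * harm N) * stirling_ratio N =
        (real N / sqrt (real N)) * fact (N - 1) * (exp (- real N) * exp (real N)) * (z + real N) ^ N / real N ^ N *
        exp ((z - 1 / 2) * harm N)"
      unfolding stirling_ratio_def f by (simp only: divide_inverse inverse_mult_distrib mult_ac)
    show ?thesis
      unfolding 3 1 2 power_divide by (simp only: divide_inverse mult_ac mult_1_right mult_1_left)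
  qed
  finally show ?thesis
    unfolding Gamma_series'_def e[symmetric] by simp
qed

lemma shift_factor_LIMSEQ:
  "(\<lambda>N. Gamma_series' z N * ((z + real N) / real N) ^ N * exp ((z - 1 / 2) * (harm N - ln (real N))))
     \<longlonglongrightarrow> Gamma z * exp z * exp ((z - 1 / 2) * euler_mascheroni)" for z :: real
proof (intro tendsto_intros Gamma_series'_LIMSEQ euler_mascheroni_LIMSEQ)
  have "(\<lambda>N. ((real N + z) / real N) powr real N) \<longlonglongrightarrow> exp z"
    by real_asymp
  also have "eventually (\<lambda>N. (real N + z) / real N > 0) sequentially"
    by real_asymp
  hence "eventually (\<lambda>N. ((real N + z) / real N) powr real N = ((z + real N) / real N) ^ N) sequentially"
    by eventually_elim (simp add: powr_realpow add.commute)
  hence "((\<lambda>N. ((real N + z) / real N) powr real N) \<longlonglongrightarrow> exp z) \<longleftrightarrow>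
     ((\<lambda>N. ((z + real N) / real N) ^ N) \<longlonglongrightarrow> exp z)"
    by (rule tendsto_cong)
  finally show "(\<lambda>N. ((z + real N) / real N) ^ N) \<longlonglongrightarrow> exp z" .
qed

section \<open>The constant in Stirling's formula\<close>

text \<open>The duplication (2N)! = 4^N (1/2)_N N! makes all powers and exponentials cancel and
  leaves the approximant of Gamma(1/2). This plays the part of Wallis' product.\<close>

lemma stirling_ratio_double:
  assumes "N > 0"
  shows "stirling_ratio N ^ 2 / stirling_ratio (2 * N) = sqrt 2 * Gamma_series' (1 / 2) N"
proof -
  have p: "fact (2 * N) = 4 ^ N * pochhammer (1 / 2) N * (fact N :: real)"
    using fact_double[of N, where 'a = real] by (simp add: power_mult)
  have nz: "pochhammer (1 / 2 :: real) N \<noteq> 0"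
    using pochhammer_pos[of "1/2::real" N] by simp
  have f: "fact N = real N * fact (N - 1)"
    using assms by (simp add: fact_reduce)
  have e: "exp (ln (real N) / 2) = sqrt (real N)"
    using assms by (simp add: powr_half_sqrt [symmetric] powr_def)
  have sq: "sqrt (real N) ^ 2 = real N" by simp
  have "stirling_ratio N ^ 2 / stirling_ratio (2 * N) =
     fact N ^ 2 * exp (real N) ^ 2 * ((2 * real N) ^ (2 * N) * (sqrt 2 * sqrt (real N))) /
      ((real N ^ N) ^ 2 * sqrt (real N) ^ 2 * (fact (2 * N) * exp (real N * 2)))"
    by (simp add: stirling_ratio_def power_divide power_mult_distrib real_sqrt_mult mult_ac)
  also have "exp (real N * 2) = exp (real N) ^ 2"
    by (simp add: power2_eq_square flip: exp_add)
  also have "(2 * real N) ^ (2 * N) = 4 ^ N * (real N ^ N) ^ 2"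
  proof -
    have "(2 * real N) ^ (2 * N) = ((2 * real N) ^ 2) ^ N" by (simp only: power_mult)
    also have "\<dots> = 4 ^ N * (real N ^ 2) ^ N" by (simp add: power_mult_distrib)
    also have "(real N ^ 2) ^ N = (real N ^ N) ^ 2" by (simp only: mult.commute flip: power_mult)
    finally show ?thesis .
  qed
  also have "fact N ^ 2 * exp (real N) ^ 2 * (4 ^ N * (real N ^ N) ^ 2 * (sqrt 2 * sqrt (real N))) /
      ((real N ^ N) ^ 2 * sqrt (real N) ^ 2 * (fact (2 * N) * exp (real N) ^ 2)) =
      fact N ^ 2 * 4 ^ N * sqrt 2 * sqrt (real N) / (real N * fact (2 * N))"
    using assms by simp
  also have "\<dots> = sqrt 2 * Gamma_series' (1 / 2) N"
    unfolding p Gamma_series'_def power2_eq_square f using assms nz by (simp add: e)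
  finally show ?thesis .
qed

text \<open>Existence of a nonzero limit S comes from the shift identity at z = 1, where the partial
  products for z - 1 = 0 are all 1. Comparing N with 2N then gives S = S^2 / S = sqrt 2 *
  Gamma(1/2).\<close>

lemma stirling_ratio_LIMSEQ: "stirling_ratio \<longlonglongrightarrow> sqrt (2 * pi)"
proof -
  define p where "p = (\<Prod>m. barnes_factor 1 m)"
  have p: "p \<noteq> 0"
    unfolding p_def by (rule prodinf_barnes_factor_nonzero) auto
  define S where "S = Gamma (1::real) * exp 1 * exp ((1 - 1 / 2) * euler_mascheroni) / p"
  have S: "S \<noteq> 0" using p by (simp add: S_def)
  let ?g = "\<lambda>N. Gamma_series' 1 N * ((1 + real N) / real N) ^ N * exp ((1 - 1 / 2) * (harm N - ln (real N))) :: real"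
  have P0: "barnes_partial 0 N = 1" for N
    by (simp add: barnes_partial_def barnes_factor_def)
  have "(\<lambda>N. ?g N / barnes_partial 1 N) \<longlonglongrightarrow> S"
    unfolding S_def p_def
    by (intro tendsto_divide shift_factor_LIMSEQ barnes_partial_LIMSEQ p[unfolded p_def])
  moreover have nz: "barnes_partial 1 N \<noteq> 0" for N
    using barnes_factor_nonzero[of 1] by (simp add: barnes_partial_def)
  have "eventually (\<lambda>N. ?g N / barnes_partial 1 N = stirling_ratio N) sequentially"
    using eventually_gt_at_top[of 0]
  proof eventually_elim
    case (elim N)
    with barnes_partial_shift_stirling[of 1 N] nz[of N] show ?case by (simp add: P0 divide_eq_eq mult_ac)
  qed
  ultimately have lim: "stirling_ratio \<longlonglongrightarrow> S"
    by (rule Lim_transform_eventually)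
  have "(\<lambda>N. stirling_ratio (2 * N)) \<longlonglongrightarrow> S"
    by (rule filterlim_compose[OF lim]) (rule mult_nat_left_at_top, simp)
  hence "(\<lambda>N. stirling_ratio N ^ 2 / stirling_ratio (2 * N)) \<longlonglongrightarrow> S ^ 2 / S"
    by (intro tendsto_intros lim S)
  moreover have "(\<lambda>N. sqrt 2 * Gamma_series' (1 / 2) N) \<longlonglongrightarrow> sqrt 2 * Gamma (1 / 2 :: real)"
    by (intro tendsto_intros Gamma_series'_LIMSEQ)
  hence "(\<lambda>N. stirling_ratio N ^ 2 / stirling_ratio (2 * N)) \<longlonglongrightarrow> sqrt 2 * Gamma (1 / 2 :: real)"
    by (rule Lim_transform_eventually)
       (use eventually_gt_at_top[of 0] in eventually_elim, simp add: stirling_ratio_double)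
  ultimately have "S ^ 2 / S = sqrt 2 * Gamma (1 / 2 :: real)"
    by (rule LIMSEQ_unique)
  hence "S = sqrt (2 * pi)"
    using S by (simp add: Gamma_one_half_real real_sqrt_mult power2_eq_square)
  with lim show ?thesis by simp
qed

text \<open>Both sides are limits of the two sides of
  \<open>barnes_partial_shift_stirling\<close>.\<close>

lemma prodinf_barnes_factor_shift:
  assumes "z \<notin> \<int>\<^sub>\<le>\<^sub>0"
  shows "(\<Prod>m. barnes_factor z m) * sqrt (2 * pi) =
     (\<Prod>m. barnes_factor (z - 1) m) * (Gamma z * exp z * exp ((z - 1 / 2) * euler_mascheroni))"
proof (rule LIMSEQ_unique)
  show "(\<lambda>N. barnes_partial z N * stirling_ratio N) \<longlonglongrightarrow> (\<Prod>m. barnes_factor z m) * sqrt (2 * pi)"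
    by (intro tendsto_intros barnes_partial_LIMSEQ stirling_ratio_LIMSEQ)
  have "(\<lambda>N. barnes_partial (z - 1) N * (Gamma_series' z N *
     ((z + real N) / real N) ^ N * exp ((z - 1 / 2) * (harm N - ln (real N))))) \<longlonglongrightarrow>
     (\<Prod>m. barnes_factor (z - 1) m) * (Gamma z * exp z * exp ((z - 1 / 2) * euler_mascheroni))"
    by (intro tendsto_mult[of "barnes_partial (z - 1)"] barnes_partial_LIMSEQ shift_factor_LIMSEQ)
  thus "(\<lambda>N. barnes_partial z N * stirling_ratio N) \<longlonglongrightarrow>
     (\<Prod>m. barnes_factor (z - 1) m) * (Gamma z * exp z * exp ((z - 1 / 2) * euler_mascheroni))"
    by (rule Lim_transform_eventually)
       (use eventually_gt_at_top[of 0] in eventually_elim, simp add: barnes_partial_shift_stirling assms)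
qed

lemma barnes_G_real:
  "barnes_G (z + 1 :: real) = exp (z / 2 * ln (2 * pi)) *
     exp (- (z * (z + 1) + euler_mascheroni * z ^ 2) / 2) * (\<Prod>m. barnes_factor z m)"
  by (simp add: barnes_G_def barnes_factor_def Let_def)

lemma barnes_G_nonzero: "z \<notin> \<int>\<^sub>\<le>\<^sub>0 \<Longrightarrow> barnes_G z \<noteq> (0 :: real)"
  using barnes_G_real[of "z - 1"] prodinf_barnes_factor_nonzero[of "z - 1"] by simp

lemma barnes_G_1: "barnes_G (1 :: real) = 1"
  using barnes_G_real[of 0] by (simp add: barnes_factor_def)

text \<open>The prefactors in the definition of \<open>barnes_G\<close> are chosen so that, from z -
  1 to z, they absorb exactly exp z, exp ((z - 1/2) \<gamma>) and the constant sqrt (2 pi), with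
  \<gamma> Euler's constant. Only Gamma z remains.\<close>

lemma barnes_G_plus1:
  assumes "z \<notin> \<int>\<^sub>\<le>\<^sub>0"
  shows "barnes_G (z + 1) = Gamma z * barnes_G (z :: real)"
proof -
  let ?g = "euler_mascheroni :: real"
  have s: "sqrt (2 * pi) = exp (1 / 2 * ln (2 * pi))"
    by (simp add: powr_half_sqrt [symmetric] powr_def)
  have "barnes_G (z + 1) * exp (1 / 2 * ln (2 * pi)) = exp (z / 2 * ln (2 * pi)) *
     exp (- (z * (z + 1) + ?g * z ^ 2) / 2) * ((\<Prod>m. barnes_factor z m) * sqrt (2 * pi))"
    by (simp add: barnes_G_real s)
  also have "\<dots> = Gamma z * (\<Prod>m. barnes_factor (z - 1) m) *
     (exp (z / 2 * ln (2 * pi)) * exp (- (z * (z + 1) + ?g * z ^ 2) / 2) * exp z * exp ((z - 1 / 2) * ?g))"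
    by (simp add: prodinf_barnes_factor_shift[OF assms])
  also have "exp (z / 2 * ln (2 * pi)) * exp (- (z * (z + 1) + ?g * z ^ 2) / 2) * exp z * exp ((z - 1 / 2) * ?g) =
     exp ((z - 1) / 2 * ln (2 * pi)) * exp (- ((z - 1) * z + ?g * (z - 1) ^ 2) / 2) * exp (1 / 2 * ln (2 * pi))"
    unfolding exp_add[symmetric]
    by (rule arg_cong[where f = exp]) (simp add: field_simps power2_eq_square)
  finally show ?thesis
    using barnes_G_real[of "z - 1"] by simp
qed

section \<open>Alternating binomial sums\<close>

text \<open>Pascal's rule: up to sign the sum is a finite difference of f at 0, and one difference
  of order k + 1 is a difference of order k of the first difference.\<close>

lemma alternating_sum_Suc:
  fixes f :: "nat \<Rightarrow> real"
  shows "(\<Sum>m\<le>Suc k. (-1) ^ m * real (Suc k choose m) * f m) =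
    (\<Sum>m\<le>k. (-1) ^ m * real (k choose m) * (f m - f (Suc m)))"
proof -
  have "(\<Sum>m\<le>Suc k. (-1) ^ m * real (Suc k choose m) * f m) =
      f 0 + (\<Sum>m\<le>k. (-1) ^ Suc m * real (k choose Suc m) * f (Suc m))
          + (\<Sum>m\<le>k. (-1) ^ Suc m * real (k choose m) * f (Suc m))"
    by (subst sum.atMost_Suc_shift) (simp add: algebra_simps sum.distrib sum_negf sum_subtractf)
  also have "f 0 + (\<Sum>m\<le>k. (-1) ^ Suc m * real (k choose Suc m) * f (Suc m)) =
      (\<Sum>m\<le>Suc k. (-1) ^ m * real (k choose m) * f m)"
    by (subst sum.atMost_Suc_shift) simp
  also have "\<dots> = (\<Sum>m\<le>k. (-1) ^ m * real (k choose m) * f m)"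
    by simp
  finally show ?thesis
    by (simp add: right_diff_distrib sum_subtractf sum_negf)
qed

text \<open>Translation by 1 keeps the leading coefficient, which therefore cancels.\<close>

lemma degree_diff_pcompose_shift:
  fixes q :: "real poly"
  assumes "degree q > 0"
  shows "degree (q - pcompose q [:1, 1:]) < degree q"
proof -
  have d: "degree (pcompose q [:1, 1:]) = degree q"
    by (simp add: degree_pcompose)
  have "coeff (q - pcompose q [:1, 1:]) (degree q) = 0"
    using lead_coeff_comp[of "[:1, 1::real:]" q] by (simp add: d)
  moreover have "degree (q - pcompose q [:1, 1:]) \<le> degree q"
    using degree_diff_le[of q "degree q" "pcompose q [:1, 1:]"] by (simp add: d)
  ultimately have "q - pcompose q [:1, 1:] = 0 \<or> degree (q - pcompose q [:1, 1:]) < degree q"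
    by (intro eq_zero_or_degree_less)
  thus ?thesis using assms by auto
qed

lemma alternating_sum_poly_eq_0:
  fixes q :: "real poly"
  assumes "degree q < k"
  shows "(\<Sum>m\<le>k. (-1) ^ m * real (k choose m) * poly q (real m)) = 0"
  using assms
proof (induction k arbitrary: q)
  case (Suc k)
  have "(\<Sum>m\<le>Suc k. (-1) ^ m * real (Suc k choose m) * poly q (real m)) =
     (\<Sum>m\<le>k. (-1) ^ m * real (k choose m) * poly (q - pcompose q [:1, 1:]) (real m))"
    unfolding alternating_sum_Suc by (simp add: poly_pcompose add.commute)
  also have "\<dots> = 0"
  proof (cases "degree q = 0")
    \<comment> \<open>The degree of a constant cannot drop further, but its difference is the zero
      polynomial.\<close>
    case True
    then obtain c where "q = [:c:]" by (rule degree_eq_zeroE)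
    thus ?thesis by simp
  next
    case False
    with degree_diff_pcompose_shift[of q] Suc.prems show ?thesis
      by (intro Suc.IH) simp
  qed
  finally show ?case .
qed simp

text \<open>This is the partial fraction expansion of k! / (y)_(k+1). The induction step takes the
  difference of the instances at y and y + 1.\<close>

lemma alternating_sum_reciprocal:
  fixes y :: real
  assumes "\<And>m. m \<le> k \<Longrightarrow> y + real m \<noteq> 0"
  shows "(\<Sum>m\<le>k. (-1) ^ m * real (k choose m) * (1 / (y + real m))) = fact k / pochhammer y (Suc k)"
  using assms
proof (induction k arbitrary: y)
  case (Suc k)
  have nz: "y \<noteq> 0" "y + real (Suc k) \<noteq> 0"
    using Suc.prems[of 0] Suc.prems[of "Suc k"] by auto
  have nz': "pochhammer (y + 1) k \<noteq> 0"
  proof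
    assume "pochhammer (y + 1) k = 0"
    then obtain m where "m < k" "y + 1 = - real m"
      by (auto simp: pochhammer_eq_0_iff)
    with Suc.prems[of "Suc m"] show False by simp
  qed
  have "(\<Sum>m\<le>Suc k. (-1) ^ m * real (Suc k choose m) * (1 / (y + real m))) =
     (\<Sum>m\<le>k. (-1) ^ m * real (k choose m) * (1 / (y + real m))) -
     (\<Sum>m\<le>k. (-1) ^ m * real (k choose m) * (1 / (y + 1 + real m)))"
    unfolding alternating_sum_Suc by (simp add: right_diff_distrib sum_subtractf add_ac)
  also have "\<dots> = fact k / pochhammer y (Suc k) - fact k / pochhammer (y + 1) (Suc k)"
  proof (intro arg_cong2[where f = minus] Suc.IH)
    fix m assume "m \<le> k"
    thus "y + real m \<noteq> 0" "y + 1 + real m \<noteq> 0"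
      using Suc.prems[of m] Suc.prems[of "Suc m"] by (auto simp: add_ac)
  qed
  also have "\<dots> = fact (Suc k) / pochhammer y (Suc (Suc k))"
  proof -
    define P F where "P = pochhammer (y + 1) k" and "F = (fact k :: real)"
    have e: "pochhammer y (Suc k) = y * P" "pochhammer (y + 1) (Suc k) = P * (y + real (Suc k))"
       "pochhammer y (Suc (Suc k)) = y * P * (y + real (Suc k))" "fact (Suc k) = real (Suc k) * F"
      using pochhammer_rec[of y k] pochhammer_rec[of y "Suc k"] pochhammer_Suc[of "y + 1" k]
      by (simp_all add: P_def F_def add_ac)
    show ?thesis
      unfolding e F_def[symmetric] using nz nz'[folded P_def]
      by (simp add: divide_simps del: of_nat_Suc) (simp add: algebra_simps)
  qed
  finally show ?case .
qed simp

text \<open>Division with remainder gives q(x) = (y + x) r(x) + q(-y). The difference of order k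
  kills r, of degree less than k, and the reciprocal sum remains.\<close>

lemma alternating_sum_poly_divide:
  fixes q :: "real poly" and y :: real
  assumes "degree q \<le> k" "\<And>m. m \<le> k \<Longrightarrow> y + real m \<noteq> 0"
  shows "(\<Sum>m\<le>k. (-1) ^ m * real (k choose m) * (poly q (real m) / (y + real m))) =
     poly q (- y) * fact k / pochhammer y (Suc k)"
proof -
  define r where "r = synthetic_div q (- y)"
  have q: "poly q x = (y + x) * poly r x + poly q (- y)" for x
    by (subst synthetic_div_correct'[of "- y" q, symmetric]) (simp add: r_def algebra_simps)
  have "(\<Sum>m\<le>k. (-1) ^ m * real (k choose m) * (poly q (real m) / (y + real m))) =
     (\<Sum>m\<le>k. (-1) ^ m * real (k choose m) * poly r (real m)
         + poly q (- y) * ((-1) ^ m * real (k choose m) * (1 / (y + real m))))"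
  proof (intro sum.cong refl)
    fix m assume "m \<in> {..k}"
    hence "y + real m \<noteq> 0" using assms(2) by simp
    thus "(-1) ^ m * real (k choose m) * (poly q (real m) / (y + real m)) =
      (-1) ^ m * real (k choose m) * poly r (real m)
         + poly q (- y) * ((-1) ^ m * real (k choose m) * (1 / (y + real m)))"
      by (subst q) (simp add: field_simps)
  qed
  also have "\<dots> = (\<Sum>m\<le>k. (-1) ^ m * real (k choose m) * poly r (real m)) +
      poly q (- y) * (\<Sum>m\<le>k. (-1) ^ m * real (k choose m) * (1 / (y + real m)))"
    by (simp only: sum.distrib sum_distrib_left)
  also have "(\<Sum>m\<le>k. (-1) ^ m * real (k choose m) * poly r (real m)) = 0"
  proof (cases "degree q = 0")
    \<comment> \<open>Here k may be 0, where no degree is less than k; the quotient r itself is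
      zero.\<close>
    case True
    hence "r = 0" by (simp add: r_def synthetic_div_eq_0_iff)
    thus ?thesis by simp
  next
    case False
    with assms(1) have "degree r < k" by (simp add: r_def degree_synthetic_div)
    thus ?thesis by (rule alternating_sum_poly_eq_0)
  qed
  finally show ?thesis
    using alternating_sum_reciprocal[OF assms(2)] by simp
qed

lemma sum_triangle_swap:
  fixes f :: "nat \<Rightarrow> nat \<Rightarrow> 'a :: comm_monoid_add"
  shows "(\<Sum>m\<le>k. \<Sum>i\<le>m. f m i) = (\<Sum>i\<le>k. \<Sum>m=i..k. f m i)"
proof (induction k)
  case (Suc k)
  have "(\<Sum>i\<le>k. \<Sum>m=i..Suc k. f m i) = (\<Sum>i\<le>k. (\<Sum>m=i..k. f m i) + f (Suc k) i)"
    by (intro sum.cong refl) simp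
  thus ?case by (simp add: Suc.IH sum.distrib add_ac)
qed simp

lemma smult_sum_right: "smult c (sum f A) = (\<Sum>i\<in>A. smult c (f i))"
  by (induction A rule: infinite_finite_induct) (simp_all add: smult_add_right)

lemma poly_pochhammer: "poly (pochhammer p n) x = pochhammer (poly p x) n"
  by (induction n) (simp_all add: pochhammer_Suc)

lemma degree_pochhammer_le: "degree (pochhammer [:a, 1::real:] n) \<le> n"
proof (induction n)
  case (Suc n)
  have "degree ([:a, 1:] + of_nat n) \<le> 1"
    by (simp add: of_nat_poly)
  with Suc show ?case
    using degree_mult_le[of "pochhammer [:a, 1:] n" "[:a, 1:] + of_nat n"]
    by (simp add: pochhammer_Suc)
qed simp

section \<open>The moment functional of the Jacobi weight\<close>

definition moment_functional :: "(nat \<Rightarrow> real) \<Rightarrow> real poly \<Rightarrow> real" where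
  "moment_functional \<mu> p = (\<Sum>m\<le>degree p. coeff p m * \<mu> m)"

text \<open>Lets polynomials of different degrees share one range of summation, as additivity
  requires.\<close>

lemma moment_functional_altdef:
  assumes "degree p \<le> n"
  shows "moment_functional \<mu> p = (\<Sum>m\<le>n. coeff p m * \<mu> m)"
  unfolding moment_functional_def
  by (rule sum.mono_neutral_left) (use assms in \<open>auto simp: coeff_eq_0\<close>)

lemma moment_functional_0 [simp]: "moment_functional \<mu> 0 = 0"
  by (simp add: moment_functional_def)

lemma moment_functional_add: "moment_functional \<mu> (p + q) = moment_functional \<mu> p + moment_functional \<mu> q"
proof -
  define n where "n = max (degree p) (degree q)"
  have "degree p \<le> n" "degree q \<le> n" "degree (p + q) \<le> n"
    by (simp_all add: n_def degree_add_le_max)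
  thus ?thesis
    by (simp add: moment_functional_altdef sum.distrib distrib_right)
qed

lemma moment_functional_smult: "moment_functional \<mu> (smult c p) = c * moment_functional \<mu> p"
  by (simp add: moment_functional_altdef[OF degree_smult_le] moment_functional_def sum_distrib_left mult_ac)

lemma moment_functional_sum: "moment_functional \<mu> (sum f A) = (\<Sum>i\<in>A. moment_functional \<mu> (f i))"
  by (induction A rule: infinite_finite_induct) (simp_all add: moment_functional_add)

lemma moment_functional_monom: "moment_functional \<mu> (monom c m) = c * \<mu> m"
proof -
  have "moment_functional \<mu> (monom c m) = (\<Sum>i\<le>m. coeff (monom c m) i * \<mu> i)"
    by (rule moment_functional_altdef) (rule degree_monom_le)
  also have "\<dots> = (\<Sum>i\<in>{m}. coeff (monom c m) i * \<mu> i)"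
    by (rule sum.mono_neutral_right) auto
  finally show ?thesis by simp
qed

lemma pochhammer_minus_of_nat_divide_fact:
  "pochhammer (- real n) m / fact m = (-1) ^ m * real (n choose m)"
proof -
  have "(-1) ^ m * real (n choose m) = ((-1) ^ m * (-1) ^ m) * (pochhammer (- real n) m / fact m)"
    by (simp add: binomial_gbinomial gbinomial_pochhammer)
  also have "(-1) ^ m * (-1) ^ m = (1 :: real)"
    by (simp flip: power_add)
  finally show ?thesis by simp
qed

text \<open>The symbol (-n)_m vanishes for m > n, so the series is a finite sum and no question of
  convergence arises, even at z = 2.\<close>

lemma hyp2F1_terminating:
  "hyp2F1 (- real n) b c z = (\<Sum>m\<le>n. (-1) ^ m * real (n choose m) * pochhammer b m / pochhammer c m * z ^ m)"
proof -
  have "hyp2F1 (- real n) b c z =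
     (\<Sum>m\<le>n. pochhammer (- real n) m * pochhammer b m / pochhammer c m * z ^ m / fact m)"
    unfolding hyp2F1_def by (rule suminf_finite) (auto simp: pochhammer_of_nat_eq_0_lemma)
  also have "\<dots> = (\<Sum>m\<le>n. (pochhammer (- real n) m / fact m) * pochhammer b m / pochhammer c m * z ^ m)"
    by (intro sum.cong refl) simp
  finally show ?thesis by (simp only: pochhammer_minus_of_nat_divide_fact)
qed

lemma Chu_Vandermonde:
  fixes a c :: real
  assumes "c > 0"
  shows "(\<Sum>m\<le>n. (-1) ^ m * real (n choose m) * (pochhammer a m / pochhammer c m)) =
    pochhammer (c - a) n / pochhammer c n"
proof -
  have "(\<Sum>m=0..n. (pochhammer a m * pochhammer (- (of_nat n)) m) / (of_nat (fact m) * pochhammer c m)) =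
      pochhammer (c - a) n / pochhammer c n"
    by (rule Vandermonde_pochhammer) (use assms in auto)
  also have "(\<Sum>m=0..n. (pochhammer a m * pochhammer (- (of_nat n)) m) / (of_nat (fact m) * pochhammer c m)) =
     (\<Sum>m\<le>n. (pochhammer (- real n) m / fact m) * (pochhammer a m / pochhammer c m))"
    by (intro sum.cong) auto
  finally show ?thesis by (simp only: pochhammer_minus_of_nat_divide_fact)
qed

text \<open>The Jacobi weight on \<open>[0, 1]\<close> has the moments \<open>(\<alpha> + 1)\<^sub>m / (\<alpha> + \<beta> + 2)\<^sub>m\<close>.\<close>

definition jacobi_moment :: "real \<Rightarrow> real \<Rightarrow> nat \<Rightarrow> real" where
  "jacobi_moment \<alpha> \<beta> m = pochhammer (\<alpha> + 1) m / pochhammer (\<alpha> + \<beta> + 2) m"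

text \<open>The reflection u -> 1 - u exchanges \<alpha> and \<beta> in the beta weight.
  Algebraically this is the Chu-Vandermonde sum.\<close>

lemma moment_functional_one_minus_power:
  assumes "\<alpha> > -1" "\<beta> > -1"
  shows "moment_functional (jacobi_moment \<alpha> \<beta>) ([:1, -1:] ^ n) =
    pochhammer (\<beta> + 1) n / pochhammer (\<alpha> + \<beta> + 2) n"
proof -
  have "[:1, -1:] = monom (-1) 1 + (1 :: real poly)"
    by (simp add: monom_altdef one_pCons)
  hence "[:1, -1::real:] ^ n = (\<Sum>m\<le>n. of_nat (n choose m) * monom (-1) 1 ^ m)"
    by (simp add: binomial_ring)
  also have "\<dots> = (\<Sum>m\<le>n. monom ((-1) ^ m * real (n choose m)) m)"
    by (intro sum.cong refl) (simp add: monom_power of_nat_monom mult_monom mult.commute)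
  finally have "moment_functional (jacobi_moment \<alpha> \<beta>) ([:1, -1:] ^ n) =
     (\<Sum>m\<le>n. (-1) ^ m * real (n choose m) * jacobi_moment \<alpha> \<beta> m)"
    by (simp add: moment_functional_sum moment_functional_monom)
  also have "\<dots> = pochhammer (\<alpha> + \<beta> + 2 - (\<alpha> + 1)) n / pochhammer (\<alpha> + \<beta> + 2) n"
    unfolding jacobi_moment_def by (rule Chu_Vandermonde) (use assms in simp)
  finally show ?thesis by (simp add: algebra_simps)
qed

lemma of_nat_mult_smult_power:
  "of_nat c * smult a q ^ m = smult (of_nat c * a ^ m) (q ^ m)" for a :: "'a :: comm_semiring_1"
  by (simp add: smult_power of_nat_poly mult.commute)

text \<open>Expand 2u - 1 = 1 - 2 (1 - u) by the binomial theorem in powers of 1 - u; (-2)^m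
  supplies both the sign and the argument 2.\<close>

lemma hyp2F1_eq_moment_functional:
  assumes "\<alpha> > -1" "\<beta> > -1"
  shows "hyp2F1 (- real n) (\<beta> + 1) (\<alpha> + \<beta> + 2) 2 =
    moment_functional (jacobi_moment \<alpha> \<beta>) ([:-1, 2:] ^ n)"
proof -
  have "[:-1, 2:] = smult (-2) [:1, -1:] + (1 :: real poly)"
    by (simp add: one_pCons)
  hence "[:-1, 2::real:] ^ n = (\<Sum>m\<le>n. of_nat (n choose m) * smult (-2) [:1, -1:] ^ m)"
    by (simp add: binomial_ring)
  also have "\<dots> = (\<Sum>m\<le>n. smult (real (n choose m) * (-2) ^ m) ([:1, -1:] ^ m))"
    by (simp only: of_nat_mult_smult_power)
  finally have "moment_functional (jacobi_moment \<alpha> \<beta>) ([:-1, 2:] ^ n) =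
     (\<Sum>m\<le>n. real (n choose m) * (-2) ^ m * (pochhammer (\<beta> + 1) m / pochhammer (\<alpha> + \<beta> + 2) m))"
    by (simp only: moment_functional_sum moment_functional_smult moment_functional_one_minus_power[OF assms])
  also have "\<dots> = hyp2F1 (- real n) (\<beta> + 1) (\<alpha> + \<beta> + 2) 2"
    unfolding hyp2F1_terminating
    by (intro sum.cong refl) (simp add: power_minus[of 2])
  finally show ?thesis ..
qed

text \<open>\<open>jacobi_shifted \<alpha> \<beta> k\<close> is \<open>jacobi_P k \<alpha> \<beta> (1 - 2 * u)\<close> as a polynomial in \<open>u\<close>.\<close>

definition jacobi_coeff :: "real \<Rightarrow> real \<Rightarrow> nat \<Rightarrow> nat \<Rightarrow> real" where
  "jacobi_coeff \<alpha> \<beta> k m = pochhammer (\<alpha> + 1) k / fact k * ((-1) ^ m * real (k choose m)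
     * pochhammer (real k + \<alpha> + \<beta> + 1) m / pochhammer (\<alpha> + 1) m)"

definition jacobi_shifted :: "real \<Rightarrow> real \<Rightarrow> nat \<Rightarrow> real poly" where
  "jacobi_shifted \<alpha> \<beta> k = (\<Sum>m\<le>k. monom (jacobi_coeff \<alpha> \<beta> k m) m)"

lemma degree_jacobi_shifted: "degree (jacobi_shifted \<alpha> \<beta> k) \<le> k"
  unfolding jacobi_shifted_def by (intro degree_sum_le) (auto intro: order.trans[OF degree_monom_le])

lemma coeff_jacobi_shifted: "coeff (jacobi_shifted \<alpha> \<beta> k) k = jacobi_coeff \<alpha> \<beta> k k"
  by (simp add: jacobi_shifted_def coeff_sum)

section \<open>Orthogonality of the shifted Jacobi polynomials\<close>

context
  fixes \<alpha> \<beta> :: real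
  assumes params: "\<alpha> > -1" "\<beta> > -1" "\<alpha> + \<beta> + 1 \<noteq> 0"
begin

lemma pochhammer_params_nonzero [simp]:
  "pochhammer (\<alpha> + 1) m \<noteq> 0" "pochhammer (\<beta> + 1) m \<noteq> 0"
  "pochhammer (\<alpha> + \<beta> + 2) m \<noteq> 0" "pochhammer (real k + \<alpha> + \<beta> + 1) m \<noteq> 0"
proof -
  \<comment> \<open>Since \<alpha> + \<beta> > -2, the sum k + j + \<alpha> + \<beta> + 1 is
    positive once k + j > 0; for k = j = 0 the third assumption applies.\<close>
  have "real k + \<alpha> + \<beta> + 1 \<noteq> - real j" for j
    using params by (cases "k = 0 \<and> j = 0") auto
  thus "pochhammer (real k + \<alpha> + \<beta> + 1) m \<noteq> 0"
    by (auto simp: pochhammer_eq_0_iff)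
qed (use params in \<open>auto simp: pochhammer_eq_0_iff\<close>)

lemma pochhammer_params_nonzero' [simp]: "pochhammer (\<alpha> + \<beta> + 1) m \<noteq> 0"
  using pochhammer_params_nonzero(4)[of 0 m] by simp

text \<open>The moment turns the sum into one over \<open>poly q m / (k + \<alpha> + \<beta> + 1 + m)\<close> with
  \<open>degree q = k\<close>, and \<open>q\<close> vanishes at the pole unless \<open>j = k\<close>.\<close>

lemma moment_monom_jacobi_shifted:
  assumes "j \<le> k"
  shows "moment_functional (jacobi_moment \<alpha> \<beta>) (monom 1 j * jacobi_shifted \<alpha> \<beta> k) =
    (if j = k then (-1) ^ k * pochhammer (\<alpha> + 1) k * pochhammer (\<beta> + 1) k * (\<alpha> + \<beta> + 1)
        / (pochhammer (\<alpha> + \<beta> + 1) k * pochhammer (real k + \<alpha> + \<beta> + 1) (Suc k)) else 0)"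
proof -
  define s where "s = \<alpha> + \<beta> + 1"
  have s: "s \<noteq> 0" "\<alpha> + \<beta> + 2 = s + 1" "\<alpha> + \<beta> + 1 = s" "real k + \<alpha> + \<beta> + 1 = real k + s" for k
    using params by (simp_all add: s_def)
  note nz = pochhammer_params_nonzero[unfolded s(2,4)] pochhammer_params_nonzero'[unfolded s(3)]
  have nz_m: "real k + s + real m \<noteq> 0" for m
    using params by (cases "k = 0 \<and> m = 0") (auto simp: s_def)
  define q where "q = pochhammer [:\<alpha> + 1, 1:] j * pochhammer [:s + 1 + real j, 1:] (k - j)"
  have "degree q \<le> j + (k - j)"
    unfolding q_def by (intro order.trans[OF degree_mult_le] add_mono degree_pochhammer_le)
  hence deg: "degree q \<le> k" using assms by simp
  have poly_q: "poly q x = pochhammer (\<alpha> + 1 + x) j * pochhammer (s + 1 + real j + x) (k - j)" for x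
    by (simp add: q_def poly_pochhammer)
  have summand: "pochhammer (real k + s) m / pochhammer (\<alpha> + 1) m * jacobi_moment \<alpha> \<beta> (j + m) =
      s / pochhammer s k * (poly q (real m) / (real k + s + real m))" for m
  proof -
    have "pochhammer (\<alpha> + 1) (j + m) = pochhammer (\<alpha> + 1) m * pochhammer (\<alpha> + 1 + real m) j"
      by (subst add.commute) (rule pochhammer_product')
    \<comment> \<open>Both sides are the symbol (s)_(k+m+1), split after k factors on the left and
      after 1 and 1 + j + m factors on the right.\<close>
    moreover have "pochhammer s k * (pochhammer (real k + s) m * (real k + s + real m)) =
        s * (pochhammer (s + 1) (j + m) * pochhammer (s + 1 + real j + real m) (k - j))"
    proof -
      have "pochhammer s k * (pochhammer (real k + s) m * (real k + s + real m)) = pochhammer s (k + Suc m)"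
        by (simp add: pochhammer_product' pochhammer_Suc add_ac)
      also have "k + Suc m = Suc ((j + m) + (k - j))" using assms by simp
      also have "pochhammer s \<dots> = s * (pochhammer (s + 1) (j + m) * pochhammer (s + 1 + real j + real m) (k - j))"
        unfolding pochhammer_rec pochhammer_product' by (simp add: add_ac)
      finally show ?thesis .
    qed
    ultimately show ?thesis
      unfolding jacobi_moment_def poly_q s(2) using nz nz_m[of m]
      by (simp add: frac_eq_eq) (simp add: mult_ac)
  qed
  have "moment_functional (jacobi_moment \<alpha> \<beta>) (monom 1 j * jacobi_shifted \<alpha> \<beta> k) =
     (\<Sum>m\<le>k. jacobi_coeff \<alpha> \<beta> k m * jacobi_moment \<alpha> \<beta> (j + m))"
    by (simp add: jacobi_shifted_def sum_distrib_left mult_monom moment_functional_sum moment_functional_monom)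
  also have "\<dots> = (\<Sum>m\<le>k. pochhammer (\<alpha> + 1) k / fact k * (s / pochhammer s k) *
      ((-1) ^ m * real (k choose m) * (poly q (real m) / (real k + s + real m))))"
  proof (intro sum.cong refl)
    fix m
    have "jacobi_coeff \<alpha> \<beta> k m * jacobi_moment \<alpha> \<beta> (j + m) = pochhammer (\<alpha> + 1) k / fact k *
        ((-1) ^ m * real (k choose m)) *
        (pochhammer (real k + s) m / pochhammer (\<alpha> + 1) m * jacobi_moment \<alpha> \<beta> (j + m))"
      by (simp add: jacobi_coeff_def s(4))
    thus "jacobi_coeff \<alpha> \<beta> k m * jacobi_moment \<alpha> \<beta> (j + m) = pochhammer (\<alpha> + 1) k / fact k * (s / pochhammer s k) *
      ((-1) ^ m * real (k choose m) * (poly q (real m) / (real k + s + real m)))"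
      unfolding summand by (simp add: mult_ac)
  qed
  also have "\<dots> = pochhammer (\<alpha> + 1) k / fact k * (s / pochhammer s k) *
      (poly q (- (real k + s)) * fact k / pochhammer (real k + s) (Suc k))"
    unfolding sum_distrib_left[symmetric]
    by (subst alternating_sum_poly_divide[OF deg]) (use nz_m in auto)
  also have "poly q (- (real k + s)) = (if j = k then (-1) ^ k * pochhammer (\<beta> + 1) k else 0)"
  proof (cases "j = k")
    case True
    \<comment> \<open>At the pole the first factor of q starts at -(\<beta> + k); read backwards
      with k signs changed it is (\<beta> + 1)_k.\<close>
    have "\<alpha> + 1 + - (real k + s) = - (\<beta> + real k)" by (simp add: s_def)
    hence "pochhammer (\<alpha> + 1 + - (real k + s)) k = (-1) ^ k * pochhammer (\<beta> + 1) k"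
      by (simp only: pochhammer_minus) simp
    thus ?thesis by (simp only: poly_q True) simp
  next
    case False
    \<comment> \<open>At the pole the second factor of q runs through k - j consecutive numbers from
      -(k - j - 1), so it contains 0.\<close>
    have "s + 1 + real j + - (real k + s) = - real (k - Suc j)"
      using False assms by simp
    moreover have "k - Suc j < k - j" using False assms by simp
    ultimately have "pochhammer (s + 1 + real j + - (real k + s)) (k - j) = 0"
      by (simp only: pochhammer_of_nat_eq_0_lemma)
    with False show ?thesis by (simp add: poly_q)
  qed
  finally show ?thesis
    unfolding s(3,4) by simp
qed

text \<open>The classical squared norm of the Jacobi polynomial divided by the total mass of the
  weight, so that its value at k = 0 is 1. The quotient (\<alpha> + \<beta> + 1) / (\<alpha> +
  \<beta> + 1)_k covers k = 0 without a case distinction.\<close>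

definition jacobi_norm :: "nat \<Rightarrow> real" where
  "jacobi_norm k = pochhammer (\<alpha> + 1) k * pochhammer (\<beta> + 1) k * (\<alpha> + \<beta> + 1)
     / (fact k * (2 * real k + \<alpha> + \<beta> + 1) * pochhammer (\<alpha> + \<beta> + 1) k)"

lemma two_k_params_nonzero: "2 * real k + \<alpha> + \<beta> + 1 \<noteq> 0"
  using params by (cases "k = 0") auto

lemma jacobi_norm_nonzero: "jacobi_norm k \<noteq> 0"
  using params two_k_params_nonzero by (simp add: jacobi_norm_def)

text \<open>Only the leading monomial of p pairs nontrivially with the polynomial of index
  k.\<close>

lemma moment_mult_jacobi_shifted:
  assumes "degree p \<le> k"
  shows "moment_functional (jacobi_moment \<alpha> \<beta>) (p * jacobi_shifted \<alpha> \<beta> k) =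
    coeff p k * ((-1) ^ k * pochhammer (\<alpha> + 1) k * pochhammer (\<beta> + 1) k * (\<alpha> + \<beta> + 1)
        / (pochhammer (\<alpha> + \<beta> + 1) k * pochhammer (real k + \<alpha> + \<beta> + 1) (Suc k)))"
proof -
  have "p = (\<Sum>j\<le>k. smult (coeff p j) (monom 1 j))"
    using poly_as_sum_of_monoms'[OF assms] by (simp add: smult_monom)
  hence "p * jacobi_shifted \<alpha> \<beta> k = (\<Sum>j\<le>k. smult (coeff p j) (monom 1 j * jacobi_shifted \<alpha> \<beta> k))"
    by (metis (no_types, lifting) mult_smult_left sum.cong sum_distrib_right)
  thus ?thesis
    by (simp add: moment_functional_sum moment_functional_smult moment_monom_jacobi_shifted
          if_distrib[of "\<lambda>x. _ * x"] sum.delta cong: if_cong)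
qed

lemma jacobi_shifted_orthogonal:
  "moment_functional (jacobi_moment \<alpha> \<beta>) (jacobi_shifted \<alpha> \<beta> l * jacobi_shifted \<alpha> \<beta> k) =
    (if k = l then jacobi_norm k else 0)"
proof -
  have less: "moment_functional (jacobi_moment \<alpha> \<beta>) (jacobi_shifted \<alpha> \<beta> l * jacobi_shifted \<alpha> \<beta> k) = 0"
    if "l < k" for l k
  proof -
    have "degree (jacobi_shifted \<alpha> \<beta> l) < k"
      using degree_jacobi_shifted[of \<alpha> \<beta> l] that by simp
    thus ?thesis by (simp add: moment_mult_jacobi_shifted coeff_eq_0)
  qed
  have "moment_functional (jacobi_moment \<alpha> \<beta>) (jacobi_shifted \<alpha> \<beta> k * jacobi_shifted \<alpha> \<beta> k) = jacobi_norm k"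
  proof -
    \<comment> \<open>The last factor of the symbol of length k + 1 enters the norm; the other k
      cancel against the leading coefficient.\<close>
    have "real k + \<alpha> + \<beta> + 1 + real k = 2 * real k + \<alpha> + \<beta> + 1" by simp
    hence "pochhammer (real k + \<alpha> + \<beta> + 1) (Suc k) =
        pochhammer (real k + \<alpha> + \<beta> + 1) k * (2 * real k + \<alpha> + \<beta> + 1)"
      by (simp only: pochhammer_Suc)
    moreover have "(-1) ^ k * (-1) ^ k = (1 :: real)" by (simp flip: power_add)
    ultimately show ?thesis
      using two_k_params_nonzero[of k]
      by (simp add: moment_mult_jacobi_shifted degree_jacobi_shifted coeff_jacobi_shifted
            jacobi_coeff_def jacobi_norm_def mult_ac)
  qed
  with less[of l k] less[of k l] show ?thesis
    by (cases l k rule: linorder_cases) (simp_all add: mult.commute)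
qed

section \<open>Jacobi polynomials in powers of 2u - 1\<close>

text \<open>This is the Taylor coefficient at x = 0, where x = 1 - 2u: the derivative of order i of
  P_k is 2^(-i) (k + \<alpha> + \<beta> + 1)_i times the Jacobi polynomial with parameters raised by
  i, and x^i = (-1)^i (2u - 1)^i turns 2^i into (-2)^i.\<close>

definition jacobi_entry :: "nat \<Rightarrow> nat \<Rightarrow> real" where
  "jacobi_entry k i = pochhammer (real k + \<alpha> + \<beta> + 1) i
     * jacobi_P (k - i) (\<alpha> + real i) (\<beta> + real i) 0 / (fact i * (-2) ^ i)"

text \<open>The right-hand side collects the coefficient of (2u - 1)^i from u^m = ((2u - 1) + 1)^m /
  2^m. The two sums agree termwise for m = l + i, by splitting binomials and Pochhammer symbols at
  i; no derivative is taken.\<close>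

lemma jacobi_entry_eq_sum:
  assumes "i \<le> k"
  shows "jacobi_entry k i = (\<Sum>m=i..k. jacobi_coeff \<alpha> \<beta> k m * real (m choose i) / 2 ^ m)"
proof -
  define N where "N = k - i"
  have k: "k = i + N" using assms by (simp add: N_def)
  have e: "real N + (\<alpha> + real i) + (\<beta> + real i) + 1 = real k + \<alpha> + \<beta> + 1 + real i"
    by (simp add: k)
  have "jacobi_entry k i = (\<Sum>l\<le>N. pochhammer (real k + \<alpha> + \<beta> + 1) i / (fact i * (-2) ^ i) *
     (pochhammer (\<alpha> + real i + 1) N / fact N) * ((-1) ^ l * real (N choose l) *
      pochhammer (real k + \<alpha> + \<beta> + 1 + real i) l / pochhammer (\<alpha> + real i + 1) l * (1 / 2) ^ l))"
    unfolding jacobi_entry_def jacobi_P_def N_def[symmetric] e hyp2F1_terminating sum_distrib_left[symmetric]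
    by (simp add: mult_ac)
  also have "\<dots> = (\<Sum>l\<le>N. jacobi_coeff \<alpha> \<beta> k (l + i) * real ((l + i) choose i) / 2 ^ (l + i))"
  proof (intro sum.cong refl)
    fix l assume "l \<in> {..N}"
    hence "(k choose (l + i)) * ((l + i) choose i) = (k choose i) * (N choose l)"
      using choose_mult[of i "l + i" k] by (simp add: k)
    hence c: "real (k choose (l + i)) * real ((l + i) choose i) = fact k / (fact i * fact N) * real (N choose l)"
      using binomial_fact[of i k, where 'a = real] assms unfolding N_def
      by (metis of_nat_mult)
    have p: "pochhammer (\<alpha> + 1) k = pochhammer (\<alpha> + 1) i * pochhammer (\<alpha> + real i + 1) N"
        "pochhammer (\<alpha> + 1) (l + i) = pochhammer (\<alpha> + 1) i * pochhammer (\<alpha> + real i + 1) l"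
        "pochhammer (real k + \<alpha> + \<beta> + 1) (l + i) =
          pochhammer (real k + \<alpha> + \<beta> + 1) i * pochhammer (real k + \<alpha> + \<beta> + 1 + real i) l"
      using pochhammer_product'[of "\<alpha> + 1" i N] pochhammer_product'[of "\<alpha> + 1" i l]
        pochhammer_product'[of "real k + \<alpha> + \<beta> + 1" i l] by (simp_all add: k add_ac)
    have nz: "pochhammer (\<alpha> + 1) i \<noteq> 0" "pochhammer (\<alpha> + real i + 1) l \<noteq> 0"
      using p(2) pochhammer_params_nonzero(1)[of "l + i"] by auto
    have "jacobi_coeff \<alpha> \<beta> k (l + i) * real ((l + i) choose i) / 2 ^ (l + i) =
      pochhammer (\<alpha> + 1) k / fact k * ((-1) ^ (l + i) * (real (k choose (l + i)) * real ((l + i) choose i))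
     * pochhammer (real k + \<alpha> + \<beta> + 1) (l + i) / pochhammer (\<alpha> + 1) (l + i)) / 2 ^ (l + i)"
      unfolding jacobi_coeff_def by simp
    also have "\<dots> = pochhammer (real k + \<alpha> + \<beta> + 1) i * ((-1) ^ i / (fact i * 2 ^ i)) *
     (pochhammer (\<alpha> + real i + 1) N / fact N) * ((-1) ^ l * real (N choose l) *
      pochhammer (real k + \<alpha> + \<beta> + 1 + real i) l / pochhammer (\<alpha> + real i + 1) l * (1 / 2 ^ l))"
      unfolding c p power_add using nz by (simp add: mult_ac)
    also have "(-1) ^ i / (fact i * 2 ^ i) = 1 / (fact i * (-2 :: real) ^ i)"
    proof -
      have "(-2 :: real) ^ i = (-1) ^ i * 2 ^ i" by (simp add: power_minus[of 2])
      moreover have "(-1) ^ i * (-1) ^ i = (1 :: real)" by (simp flip: power_add)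
      ultimately show ?thesis by (simp add: divide_simps)
    qed
    finally show "pochhammer (real k + \<alpha> + \<beta> + 1) i / (fact i * (-2) ^ i) *
     (pochhammer (\<alpha> + real i + 1) N / fact N) * ((-1) ^ l * real (N choose l) *
      pochhammer (real k + \<alpha> + \<beta> + 1 + real i) l / pochhammer (\<alpha> + real i + 1) l * (1 / 2) ^ l) =
      jacobi_coeff \<alpha> \<beta> k (l + i) * real ((l + i) choose i) / 2 ^ (l + i)"
      by (simp add: power_divide)
  qed
  also have "\<dots> = (\<Sum>m=i..k. jacobi_coeff \<alpha> \<beta> k m * real (m choose i) / 2 ^ m)"
    using sum.shift_bounds_cl_nat_ivl[of "\<lambda>m. jacobi_coeff \<alpha> \<beta> k m * real (m choose i) / 2 ^ m" 0 i N]
    by (simp add: k atMost_atLeast0 add_ac)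
  finally show ?thesis .
qed

lemma monom_eq_sum_powers:
  "monom (1::real) m = (\<Sum>i\<le>m. smult (real (m choose i) / 2 ^ m) ([:-1, 2:] ^ i))"
proof -
  have "monom (1::real) 1 = smult (1 / 2) ([:-1, 2:] + 1)"
    by (simp add: monom_altdef one_pCons)
  hence "monom (1::real) m = smult ((1 / 2) ^ m) (([:-1, 2:] + 1) ^ m)"
    by (metis monom_power mult_1 power_one smult_power)
  also have "([:-1, 2:] + 1 :: real poly) ^ m = (\<Sum>i\<le>m. of_nat (m choose i) * [:-1, 2:] ^ i)"
    by (simp add: binomial_ring)
  also have "smult ((1 / 2) ^ m) \<dots> = (\<Sum>i\<le>m. smult (real (m choose i) / 2 ^ m) ([:-1, 2:] ^ i))"
    by (simp add: smult_sum_right of_nat_poly power_divide)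
  finally show ?thesis .
qed

text \<open>The range reaches up to n so that all rows of the coefficient matrix have the same
  length. The guard matters: for i > k the truncated k - i is 0 and \<open>jacobi_entry k i\<close>
  would not vanish.\<close>

lemma jacobi_shifted_expansion:
  assumes "k \<le> n"
  shows "jacobi_shifted \<alpha> \<beta> k = (\<Sum>i\<le>n. smult (if i \<le> k then jacobi_entry k i else 0) ([:-1, 2:] ^ i))"
proof -
  have "jacobi_shifted \<alpha> \<beta> k = (\<Sum>m\<le>k. smult (jacobi_coeff \<alpha> \<beta> k m) (monom 1 m))"
    by (simp add: jacobi_shifted_def smult_monom)
  also have "\<dots> = (\<Sum>m\<le>k. \<Sum>i\<le>m. smult (jacobi_coeff \<alpha> \<beta> k m * real (m choose i) / 2 ^ m) ([:-1, 2:] ^ i))"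
    by (subst monom_eq_sum_powers) (simp add: smult_sum_right)
  also have "\<dots> = (\<Sum>i\<le>k. \<Sum>m=i..k. smult (jacobi_coeff \<alpha> \<beta> k m * real (m choose i) / 2 ^ m) ([:-1, 2:] ^ i))"
    by (rule sum_triangle_swap)
  also have "\<dots> = (\<Sum>i\<le>k. smult (jacobi_entry k i) ([:-1, 2:] ^ i))"
    by (intro sum.cong refl) (simp add: jacobi_entry_eq_sum smult_sum)
  also have "\<dots> = (\<Sum>i\<le>n. smult (if i \<le> k then jacobi_entry k i else 0) ([:-1, 2:] ^ i))"
    by (rule sum.mono_neutral_cong_left) (use assms in auto)
  finally show ?thesis .
qed

end

section \<open>The determinant and the inverse\<close>

text \<open>If D A D^T = H is diagonal, then det A = det H / (det D)^2 and the inverse of A is D^T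
  H^(-1) D, which is B.\<close>

lemma congruence_diagonal:
  fixes A D B :: "real mat"
  assumes carrier: "A \<in> carrier_mat N N" "D \<in> carrier_mat N N" "B \<in> carrier_mat N N"
  assumes lower: "\<And>i j. i < j \<Longrightarrow> j < N \<Longrightarrow> D $$ (i, j) = 0"
  assumes diag: "\<And>i. i < N \<Longrightarrow> D $$ (i, i) \<noteq> 0"
  assumes h: "\<And>i. i < N \<Longrightarrow> h i \<noteq> 0"
  assumes DAD: "\<And>k l. k < N \<Longrightarrow> l < N \<Longrightarrow>
    (\<Sum>i<N. \<Sum>j<N. D $$ (k, i) * A $$ (i, j) * D $$ (l, j)) = (if k = l then h k else 0)"
  assumes B: "\<And>i j. i < N \<Longrightarrow> j < N \<Longrightarrow> B $$ (i, j) = (\<Sum>k<N. D $$ (k, i) * D $$ (k, j) / h k)"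
  shows "det A = (\<Prod>k<N. h k / D $$ (k, k) ^ 2)" "A * B = 1\<^sub>m N" "B * A = 1\<^sub>m N"
proof -
  note [simp] = carrier carrier[THEN carrier_matD(1)] carrier[THEN carrier_matD(2)]
  define H where "H = mat N N (\<lambda>(i, j). if i = j then h i else 0)"
  \<comment> \<open>C is H^(-1) D, so B = D^T C and H C = D.\<close>
  define C where "C = mat N N (\<lambda>(k, j). D $$ (k, j) / h k)"
  have [simp]: "H \<in> carrier_mat N N" "C \<in> carrier_mat N N"
    by (simp_all add: H_def C_def)
  have H: "D * A * transpose_mat D = H"
  proof (rule eq_matI)
    fix k l assume "k < dim_row H" "l < dim_col H"
    hence kl: "k < N" "l < N" by (simp_all add: H_def)
    hence "(D * A * transpose_mat D) $$ (k, l) = (\<Sum>j<N. (\<Sum>i<N. D $$ (k, i) * A $$ (i, j)) * D $$ (l, j))"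
      using carrier by (simp add: scalar_prod_def atLeast0LessThan)
    also have "\<dots> = (\<Sum>i<N. \<Sum>j<N. D $$ (k, i) * A $$ (i, j) * D $$ (l, j))"
      by (subst sum.swap) (simp add: sum_distrib_right)
    finally show "(D * A * transpose_mat D) $$ (k, l) = H $$ (k, l)"
      using DAD kl by (simp add: H_def)
  qed (use carrier in \<open>simp_all add: H_def\<close>)
  have B_eq: "B = transpose_mat D * C"
  proof (rule eq_matI)
    fix i j assume "i < dim_row (transpose_mat D * C)" "j < dim_col (transpose_mat D * C)"
    hence "i < N" "j < N" using carrier by (simp_all add: C_def)
    thus "B $$ (i, j) = (transpose_mat D * C) $$ (i, j)"
      using carrier by (simp add: B C_def scalar_prod_def atLeast0LessThan)
  qed (use carrier in \<open>simp_all add: C_def\<close>)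
  have HC: "H * C = D"
  proof (rule eq_matI)
    fix i j assume "i < dim_row D" "j < dim_col D"
    hence ij: "i < N" "j < N" using carrier by simp_all
    hence "(H * C) $$ (i, j) = (\<Sum>k<N. (if i = k then h i else 0) * (D $$ (k, j) / h k))"
      by (simp add: H_def C_def scalar_prod_def atLeast0LessThan)
    also have "\<dots> = (\<Sum>k<N. if i = k then D $$ (k, j) else 0)"
      using h by (intro sum.cong) auto
    finally show "(H * C) $$ (i, j) = D $$ (i, j)" using ij by simp
  qed (use carrier in \<open>simp_all add: H_def C_def\<close>)
  have det_D: "det D = (\<Prod>k<N. D $$ (k, k))"
    using det_lower_triangular[OF lower carrier(2)] carrier by (simp add: prod_list_diag_prod atLeast0LessThan)
  have det_H: "det H = (\<Prod>k<N. h k)"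
    using det_lower_triangular[of N H] by (simp add: prod_list_diag_prod H_def atLeast0LessThan)
  have det_D_nz: "det D \<noteq> 0"
    using diag by (simp add: det_D)
  have "det D * det A * det D = det H"
    unfolding H[symmetric]
    by (simp add: det_mult[of _ N] det_transpose[of _ N] mult_carrier_mat[of _ N N _ N])
  hence "det A = det H / det D ^ 2"
    using det_D_nz by (simp add: field_simps power2_eq_square)
  thus "det A = (\<Prod>k<N. h k / D $$ (k, k) ^ 2)"
    by (simp add: det_D det_H prod_dividef prod_power_distrib)
  \<comment> \<open>D (A B) = (D A D^T) C = H C = D, and the invertible D is then cancelled on the
    left.\<close>
  have "D * (A * B) = D * A * transpose_mat D * C"
    unfolding B_eq by (simp add: assoc_mult_mat[of _ N N _ N _ N] mult_carrier_mat[of _ N N _ N])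
  hence DAB: "D * (A * B) = D"
    by (simp only: H HC)
  obtain E where E: "E \<in> carrier_mat N N" "E * D = 1\<^sub>m N"
    using det_non_zero_imp_unit[OF carrier(2) det_D_nz, of "()"]
    by (auto simp: Units_def ring_mat_def)
  have "A * B = (E * D) * (A * B)"
    using E by simp
  also have "\<dots> = E * (D * (A * B))"
    using E(1) by (simp add: assoc_mult_mat[of _ N N _ N _ N] mult_carrier_mat[of _ N N _ N])
  also have "\<dots> = 1\<^sub>m N" by (simp only: DAB E)
  finally show AB: "A * B = 1\<^sub>m N" .
  show "B * A = 1\<^sub>m N"
    by (rule mat_mult_left_right_inverse[OF _ _ AB]) simp_all
qed

section \<open>The closed form for consecutive sizes\<close>

lemma plus_of_nat_notin_nonpos_Ints:
  fixes z :: real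
  assumes "z \<notin> \<int>\<^sub>\<le>\<^sub>0"
  shows "z + real n \<notin> \<int>\<^sub>\<le>\<^sub>0"
proof
  assume "z + real n \<in> \<int>\<^sub>\<le>\<^sub>0"
  then obtain m where "z + real n = - real m" by (elim nonpos_Ints_cases')
  hence "z = - real (m + n)" by simp
  with assms show False by (metis minus_of_nat_in_nonpos_Ints)
qed

lemma barnes_G_plus_Suc:
  fixes z :: real
  assumes "z \<notin> \<int>\<^sub>\<le>\<^sub>0"
  shows "barnes_G (z + real (Suc n)) = Gamma (z + real n) * barnes_G (z + real n)"
  using barnes_G_plus1[OF plus_of_nat_notin_nonpos_Ints[OF assms, of n]] by (simp add: add_ac)

text \<open>The complex duplication formula on the real axis, at z / 2 because the closed form has
  half-sized arguments.\<close>

lemma Gamma_legendre_duplication_real: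
  fixes z :: real
  assumes "z / 2 \<notin> \<int>\<^sub>\<le>\<^sub>0" "(z + 1) / 2 \<notin> \<int>\<^sub>\<le>\<^sub>0"
  shows "Gamma (z / 2) * Gamma ((z + 1) / 2) = 2 powr (1 - z) * sqrt pi * Gamma z"
proof -
  have e: "complex_of_real (z / 2) + 1 / 2 = of_real ((z + 1) / 2)"
    "2 * complex_of_real (z / 2) = of_real z"
    by (simp_all add: add_divide_distrib)
  have "exp ((1 - complex_of_real z) * of_real (ln 2)) = of_real (exp ((1 - z) * ln 2))"
    by (simp only: of_real_mult of_real_diff of_real_1 flip: exp_of_real)
  hence pw: "exp ((1 - complex_of_real z) * of_real (ln 2)) = of_real (2 powr (1 - z))"
    by (simp add: powr_def)
  have "complex_of_real (Gamma (z / 2) * Gamma ((z + 1) / 2)) = of_real (2 powr (1 - z) * sqrt pi * Gamma z)"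
    using Gamma_legendre_duplication[of "complex_of_real (z / 2)",
        unfolded e pw of_real_in_nonpos_Ints_iff Gamma_complex_of_real, OF assms]
    by (simp only: of_real_mult)
  thus ?thesis by (simp only: of_real_eq_iff)
qed

lemma not_nonpos_Ints_gt:
  fixes z :: real
  assumes "z > -1" "z \<noteq> 0"
  shows "z \<notin> \<int>\<^sub>\<le>\<^sub>0"
proof
  assume "z \<in> \<int>\<^sub>\<le>\<^sub>0"
  then obtain n where "z = - real n" by (auto elim!: nonpos_Ints_cases')
  with assms show False by (cases n) auto
qed

context
  fixes \<alpha> \<beta> :: real
  assumes params: "\<alpha> > -1" "\<beta> > -1" "\<alpha> + \<beta> + 1 \<noteq> 0"
begin

text \<open>\<open>N\<close> is the size \<open>n + 1\<close> of the matrix.\<close>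

definition hankel_closed_form :: "nat \<Rightarrow> real" where
  "hankel_closed_form N =
      (Gamma (\<alpha> + \<beta> + 2) * 2 powr (- (2 * \<alpha> + 2 * \<beta> + real N)) * pi
         / (Gamma (\<alpha> + 1) * Gamma (\<beta> + 1))) ^ N
      * (barnes_G (1 + real N) * barnes_G ((\<alpha> + \<beta> + 1) / 2) ^ 2 * barnes_G ((\<alpha> + \<beta> + 2) / 2) ^ 2
         / (barnes_G ((\<alpha> + \<beta> + 1) / 2 + real N) ^ 2 * barnes_G ((\<alpha> + \<beta> + 2) / 2 + real N) ^ 2))
      * (barnes_G (\<alpha> + \<beta> + 1 + real N) * barnes_G (\<alpha> + 1 + real N) * barnes_G (\<beta> + 1 + real N)
         / (pochhammer ((\<alpha> + \<beta> + 1) / 2) N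
            * barnes_G (\<alpha> + \<beta> + 1) * barnes_G (\<alpha> + 1) * barnes_G (\<beta> + 1)))"

lemma params_not_nonpos_Ints:
  "\<alpha> + 1 \<notin> \<int>\<^sub>\<le>\<^sub>0" "\<beta> + 1 \<notin> \<int>\<^sub>\<le>\<^sub>0" "\<alpha> + \<beta> + 1 \<notin> \<int>\<^sub>\<le>\<^sub>0" "\<alpha> + \<beta> + 2 \<notin> \<int>\<^sub>\<le>\<^sub>0"
  "(\<alpha> + \<beta> + 1) / 2 \<notin> \<int>\<^sub>\<le>\<^sub>0" "(\<alpha> + \<beta> + 2) / 2 \<notin> \<int>\<^sub>\<le>\<^sub>0"
  by (rule not_nonpos_Ints_gt; use params in simp)+

lemma hankel_closed_form_0: "hankel_closed_form 0 = 1"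
  using barnes_G_nonzero[OF params_not_nonpos_Ints(1)] barnes_G_nonzero[OF params_not_nonpos_Ints(2)]
    barnes_G_nonzero[OF params_not_nonpos_Ints(3)] barnes_G_nonzero[OF params_not_nonpos_Ints(5)]
    barnes_G_nonzero[OF params_not_nonpos_Ints(6)]
  by (simp add: hankel_closed_form_def barnes_G_1)

text \<open>Each Barnes function that depends on the size contributes one Gamma factor. The two
  squared ones in the denominator merge, by duplication, into Gamma(s + 2N)^2, and the Gamma
  quotients become Pochhammer symbols.\<close>

lemma hankel_closed_form_Suc:
  "hankel_closed_form (Suc N) = hankel_closed_form N *
     (pochhammer (\<alpha> + 1) N * pochhammer (\<beta> + 1) N * fact N * 4 ^ N * (\<alpha> + \<beta> + 1)
       / ((2 * real N + \<alpha> + \<beta> + 1) * pochhammer (\<alpha> + \<beta> + 1) N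
          * pochhammer (real N + \<alpha> + \<beta> + 1) N ^ 2))"
proof -
  define s where "s = \<alpha> + \<beta> + 1"
  have s: "\<alpha> + \<beta> + 2 = s + 1" "\<alpha> + \<beta> + 1 = s" "real N + s = s + real N"
    "2 * \<alpha> + 2 * \<beta> = 2 * s - 2" "real N + \<alpha> + \<beta> + 1 = s + real N" "2 * real N + \<alpha> + \<beta> + 1 = s + 2 * real N"
    by (simp_all add: s_def)
  note ni = params_not_nonpos_Ints[unfolded s(1,2)]
  have nis: "z + real m \<notin> \<int>\<^sub>\<le>\<^sub>0" if "z \<notin> \<int>\<^sub>\<le>\<^sub>0" for z :: real and m
    using that by (rule plus_of_nat_notin_nonpos_Ints)
  define P where "P = Gamma (s + 1) * pi / (Gamma (\<alpha> + 1) * Gamma (\<beta> + 1))"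
  define g1 g2 where "g1 = Gamma (s / 2 + real N)" and "g2 = Gamma ((s + 1) / 2 + real N)"
  have nz: "Gamma (\<alpha> + 1) \<noteq> 0" "Gamma (\<beta> + 1) \<noteq> 0" "Gamma s \<noteq> 0" "Gamma (s + real N) \<noteq> 0"
     "Gamma (s + 2 * real N) \<noteq> 0"
    using ni nis[OF ni(3), of N] nis[OF ni(3), of "2 * N"] by (simp_all add: Gamma_eq_zero_iff)
  have "g1 * g2 = 2 powr (1 - (s + 2 * real N)) * sqrt pi * Gamma (s + 2 * real N)"
    using Gamma_legendre_duplication_real[of "s + 2 * real N"] nis[OF ni(5), of N] nis[OF ni(6), of N]
    by (simp add: g1_def g2_def add_divide_distrib add_ac)
  hence dup: "g1 ^ 2 * g2 ^ 2 = 2 powr (2 - 2 * s - 4 * real N) * pi * Gamma (s + 2 * real N) ^ 2"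
    by (simp add: power_mult_distrib [symmetric])
       (simp add: power_mult_distrib powr_power algebra_simps)
  \<comment> \<open>The base depends on the size as well, so the step from N to N + 1 lowers the
    exponent by (2s - 2) + (2N + 1).\<close>
  have pw: "(2 powr (- (2 * s - 2 + real (Suc N)))) ^ Suc N =
     (2 powr (- (2 * s - 2 + real N))) ^ N * 2 powr (1 - 2 * s - 2 * real N)"
    by (simp add: powr_power powr_add [symmetric] del: power_Suc) (simp add: algebra_simps)
  have four: "2 powr (1 - 2 * s - 2 * real N) = 4 ^ N * 2 powr (2 - 2 * s - 4 * real N) / 2"
  proof -
    have "(4::real) ^ N = 2 powr (2 * real N)"
      by (simp add: powr_powr [symmetric] powr_realpow)
    moreover have "1 - 2 * s - 2 * real N = 2 * real N + (2 - 2 * s - 4 * real N) - 1"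
      by simp
    ultimately show ?thesis by (simp only: powr_add powr_diff) simp
  qed
  have poch: "pochhammer (\<alpha> + 1) N = Gamma (\<alpha> + 1 + real N) / Gamma (\<alpha> + 1)"
    "pochhammer (\<beta> + 1) N = Gamma (\<beta> + 1 + real N) / Gamma (\<beta> + 1)"
    "pochhammer s N = Gamma (s + real N) / Gamma s"
    "pochhammer (s + real N) N = Gamma (s + 2 * real N) / Gamma (s + real N)"
    using ni nis[OF ni(3), of N] by (simp_all add: pochhammer_Gamma add_ac)
  have Gs: "Gamma (s + 1) = s * Gamma s"
    using ni(3) by (intro Gamma_plus1)
  define w where "w = 2 powr (2 - 2 * s - 4 * real N)"
  have w: "w \<noteq> 0" by (simp add: w_def)
  have sN: "s + 2 * real N \<noteq> 0"
    using nis[OF ni(3), of "2 * N"] by auto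
  \<comment> \<open>The divisor s / 2 + N is the new factor of the symbol (s / 2)_(N+1); doubling it
    to s + 2N uses up the 1/2 from \<open>four\<close>.\<close>
  have key: "P * (4 ^ N * w / 2) * fact N / (w * pi * Gamma (s + 2 * real N) ^ 2) *
      (Gamma (s + real N) * Gamma (\<alpha> + 1 + real N) * Gamma (\<beta> + 1 + real N)) / (s / 2 + real N) =
      (pochhammer (\<alpha> + 1) N * pochhammer (\<beta> + 1) N * fact N * 4 ^ N * s
       / ((s + 2 * real N) * pochhammer s N * pochhammer (s + real N) N ^ 2))"
  proof -
    have "s / 2 + real N = (s + 2 * real N) / 2" by simp
    thus ?thesis
      unfolding poch P_def Gs power_divide using nz w sN
      by (simp only:) (simp add: power2_eq_square mult_ac)
  qed
  have G: "barnes_G (1 + real (Suc N)) = fact N * barnes_G (1 + real N :: real)"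
    "barnes_G (s / 2 + real (Suc N)) = g1 * barnes_G (s / 2 + real N)"
    "barnes_G ((s + 1) / 2 + real (Suc N)) = g2 * barnes_G ((s + 1) / 2 + real N)"
    "barnes_G (s + real (Suc N)) = Gamma (s + real N) * barnes_G (s + real N)"
    "barnes_G (\<alpha> + 1 + real (Suc N)) = Gamma (\<alpha> + 1 + real N) * barnes_G (\<alpha> + 1 + real N)"
    "barnes_G (\<beta> + 1 + real (Suc N)) = Gamma (\<beta> + 1 + real N) * barnes_G (\<beta> + 1 + real N)"
    using barnes_G_plus_Suc[of 1 N] ni Gamma_fact[of N, where 'a = real] unfolding g1_def g2_def
    by (simp_all add: barnes_G_plus_Suc del: of_nat_Suc)
  have H: "hankel_closed_form M = P ^ M * (2 powr (- (2 * s - 2 + real M))) ^ M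
      * (barnes_G (1 + real M) * barnes_G (s / 2) ^ 2 * barnes_G ((s + 1) / 2) ^ 2
         / (barnes_G (s / 2 + real M) ^ 2 * barnes_G ((s + 1) / 2 + real M) ^ 2))
      * (barnes_G (s + real M) * barnes_G (\<alpha> + 1 + real M) * barnes_G (\<beta> + 1 + real M)
         / (pochhammer (s / 2) M * barnes_G s * barnes_G (\<alpha> + 1) * barnes_G (\<beta> + 1)))" for M
    unfolding hankel_closed_form_def s(1,2,4) P_def power_mult_distrib[symmetric] by (simp add: mult_ac)
  have "hankel_closed_form (Suc N) = hankel_closed_form N *
      (P * 2 powr (1 - 2 * s - 2 * real N) * fact N / (g1 ^ 2 * g2 ^ 2) *
      (Gamma (s + real N) * Gamma (\<alpha> + 1 + real N) * Gamma (\<beta> + 1 + real N)) / (s / 2 + real N))"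
    unfolding H G pw pochhammer_Suc power_Suc[of P] power_mult_distrib by (simp add: mult_ac)
  also note dup
  also note four
  also note key[unfolded w_def]
  finally show ?thesis
    unfolding s(2,5,6) .
qed

end

text \<open>The ratio of consecutive closed forms is the N-th norm over the squared diagonal
  coefficient, and both sides are 1 for the empty matrix.\<close>

lemma hankel_closed_form_eq_prod:
  assumes "\<alpha> > -1" "\<beta> > -1" "\<alpha> + \<beta> + 1 \<noteq> 0"
  shows "hankel_closed_form \<alpha> \<beta> N = (\<Prod>k<N. jacobi_norm \<alpha> \<beta> k / jacobi_entry \<alpha> \<beta> k k ^ 2)"
proof (induction N)
  case (Suc N)
  have [simp]: "jacobi_entry \<alpha> \<beta> N N =
      pochhammer (real N + \<alpha> + \<beta> + 1) N / (fact N * (-2) ^ N)"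
    using hyp2F1_terminating[of 0] by (simp add: jacobi_entry_def[OF assms] jacobi_P_def)
  have sq: "(-2 :: real) ^ N * (-2) ^ N = 4 ^ N"
    by (simp flip: power_mult_distrib)
  have "jacobi_norm \<alpha> \<beta> N / jacobi_entry \<alpha> \<beta> N N ^ 2 =
     pochhammer (\<alpha> + 1) N * pochhammer (\<beta> + 1) N * fact N * 4 ^ N * (\<alpha> + \<beta> + 1)
       / ((2 * real N + \<alpha> + \<beta> + 1) * pochhammer (\<alpha> + \<beta> + 1) N
          * pochhammer (real N + \<alpha> + \<beta> + 1) N ^ 2)"
    by (simp add: jacobi_norm_def[OF assms] power_divide power_mult_distrib sq power2_eq_square mult_ac)
  with Suc.IH show ?case
    by (simp add: hankel_closed_form_Suc[OF assms])
qed (simp add: hankel_closed_form_0[OF assms])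

theorem theorem2p4:
  fixes \<alpha> \<beta> :: real and n :: nat and A B :: "real mat"
  assumes "\<alpha> > -1" and "\<beta> > -1" and "\<alpha> + \<beta> + 1 \<noteq> 0"
  defines "A \<equiv> mat (n + 1) (n + 1)
      (\<lambda>(i, j). hyp2F1 (- real i - real j) (\<beta> + 1) (\<alpha> + \<beta> + 2) 2)"
    and "B \<equiv> mat (n + 1) (n + 1)
      (\<lambda>(i, j). \<Sum>k = max i j..n.
         fact k * (2 * real k + \<alpha> + \<beta> + 1) * (pochhammer (\<alpha> + \<beta> + 1) k / (\<alpha> + \<beta> + 1))
         / ((-2) ^ (i + j) * fact i * fact j * pochhammer (\<alpha> + 1) k * pochhammer (\<beta> + 1) k)
         * (pochhammer (real k + \<alpha> + \<beta> + 1) i * jacobi_P (k - i) (\<alpha> + real i) (\<beta> + real i) 0)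
         * (pochhammer (real k + \<alpha> + \<beta> + 1) j * jacobi_P (k - j) (\<alpha> + real j) (\<beta> + real j) 0))"
  shows "(det A =
      (Gamma (\<alpha> + \<beta> + 2) * 2 powr (- (2 * \<alpha> + 2 * \<beta> + real n + 1)) * pi
         / (Gamma (\<alpha> + 1) * Gamma (\<beta> + 1))) ^ (n + 1)
      * (barnes_G (real n + 2) * barnes_G ((\<alpha> + \<beta> + 1) / 2) ^ 2 * barnes_G ((\<alpha> + \<beta> + 2) / 2) ^ 2
         / (barnes_G ((\<alpha> + \<beta> + 3) / 2 + real n) ^ 2 * barnes_G ((\<alpha> + \<beta> + 4) / 2 + real n) ^ 2))
      * (barnes_G (\<alpha> + \<beta> + real n + 2) * barnes_G (\<alpha> + real n + 2) * barnes_G (\<beta> + real n + 2)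
         / (pochhammer ((\<alpha> + \<beta> + 1) / 2) (n + 1)
            * barnes_G (\<alpha> + \<beta> + 1) * barnes_G (\<alpha> + 1) * barnes_G (\<beta> + 1))))
    \<and> inverts_mat A B \<and> inverts_mat B A"
proof -
  note params = assms(1-3)
  let ?e = "jacobi_entry \<alpha> \<beta>" and ?h = "jacobi_norm \<alpha> \<beta>"
  let ?L = "moment_functional (jacobi_moment \<alpha> \<beta>)"
  define D where "D = mat (n + 1) (n + 1) (\<lambda>(k, i). if i \<le> k then ?e k i else 0)"
  have carrier: "A \<in> carrier_mat (n + 1) (n + 1)" "D \<in> carrier_mat (n + 1) (n + 1)"
    "B \<in> carrier_mat (n + 1) (n + 1)"
    by (simp_all add: A_def B_def D_def)
  have lower: "D $$ (i, j) = 0" if "i < j" "j < n + 1" for i j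
    using that by (simp add: D_def)
  have diag: "D $$ (i, i) \<noteq> 0" if "i < n + 1" for i
    using that hyp2F1_terminating[of 0] pochhammer_params_nonzero[OF params]
    by (simp add: D_def jacobi_entry_def[OF params] jacobi_P_def)
  \<comment> \<open>A is the Gram matrix of the powers of 2u - 1 under the functional, so D A D^T is
    the Gram matrix of the Jacobi polynomials.\<close>
  have A: "A $$ (i, j) = ?L ([:-1, 2:] ^ i * [:-1, 2:] ^ j)" if "i < n + 1" "j < n + 1" for i j
    using that hyp2F1_eq_moment_functional[OF params(1,2), of "i + j"]
    by (simp add: A_def power_add)
  have DAD: "(\<Sum>i<n + 1. \<Sum>j<n + 1. D $$ (k, i) * A $$ (i, j) * D $$ (l, j)) = (if k = l then ?h k else 0)"
    if "k < n + 1" "l < n + 1" for k l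
  proof -
    have expansion: "jacobi_shifted \<alpha> \<beta> m = (\<Sum>i<n + 1. smult (D $$ (m, i)) ([:-1, 2:] ^ i))"
      if "m < n + 1" for m
      unfolding jacobi_shifted_expansion[OF params, of m n, OF less_Suc_eq_le[THEN iffD1, OF that[unfolded Suc_eq_plus1[symmetric]]]]
      using that by (intro sum.cong) (auto simp: D_def)
    have "(if k = l then ?h k else 0) = ?L (jacobi_shifted \<alpha> \<beta> k * jacobi_shifted \<alpha> \<beta> l)"
      using jacobi_shifted_orthogonal[OF params, of k l] by auto
    also have "\<dots> = (\<Sum>i<n + 1. \<Sum>j<n + 1. D $$ (k, i) * (D $$ (l, j) * ?L ([:-1, 2:] ^ i * [:-1, 2:] ^ j)))"
      unfolding expansion[OF that(1)] expansion[OF that(2)] sum_product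
      by (simp only: moment_functional_sum mult_smult_left mult_smult_right moment_functional_smult mult_ac)
    also have "\<dots> = (\<Sum>i<n + 1. \<Sum>j<n + 1. D $$ (k, i) * A $$ (i, j) * D $$ (l, j))"
      by (intro sum.cong refl) (simp add: A)
    finally show ?thesis ..
  qed
  have B: "B $$ (i, j) = (\<Sum>k<n + 1. D $$ (k, i) * D $$ (k, j) / ?h k)" if "i < n + 1" "j < n + 1" for i j
  proof -
    \<comment> \<open>The weight of the summand with index k is 1 / \<open>jacobi_norm\<close>, and
      (-2)^(i+j) i! j! is shared between the two coefficients.\<close>
    have "B $$ (i, j) = (\<Sum>k = max i j..n. ?e k i * ?e k j / ?h k)"
      unfolding B_def using that
      by (simp add: jacobi_entry_def[OF params] jacobi_norm_def[OF params] power_add mult_ac)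
    \<comment> \<open>Summands with k < max i j vanish because D is lower triangular.\<close>
    also have "\<dots> = (\<Sum>k<n + 1. D $$ (k, i) * D $$ (k, j) / ?h k)"
      by (rule sum.mono_neutral_cong_left) (use that in \<open>auto simp: D_def\<close>)
    finally show ?thesis .
  qed
  note inv = congruence_diagonal[OF carrier lower diag _ DAD B]
  have det: "det A = (\<Prod>k<n + 1. ?h k / D $$ (k, k) ^ 2)"
    by (rule inv(1)) (simp_all add: jacobi_norm_nonzero[OF params])
  have AB: "A * B = 1\<^sub>m (n + 1)"
    by (rule inv(2)) (simp_all add: jacobi_norm_nonzero[OF params])
  have BA: "B * A = 1\<^sub>m (n + 1)"
    by (rule inv(3)) (simp_all add: jacobi_norm_nonzero[OF params])
  have "det A = hankel_closed_form \<alpha> \<beta> (n + 1)"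
    unfolding det hankel_closed_form_eq_prod[OF params]
    by (intro prod.cong refl) (simp add: D_def)
  also have "\<dots> = (Gamma (\<alpha> + \<beta> + 2) * 2 powr (- (2 * \<alpha> + 2 * \<beta> + real n + 1)) * pi
         / (Gamma (\<alpha> + 1) * Gamma (\<beta> + 1))) ^ (n + 1)
      * (barnes_G (real n + 2) * barnes_G ((\<alpha> + \<beta> + 1) / 2) ^ 2 * barnes_G ((\<alpha> + \<beta> + 2) / 2) ^ 2
         / (barnes_G ((\<alpha> + \<beta> + 3) / 2 + real n) ^ 2 * barnes_G ((\<alpha> + \<beta> + 4) / 2 + real n) ^ 2))
      * (barnes_G (\<alpha> + \<beta> + real n + 2) * barnes_G (\<alpha> + real n + 2) * barnes_G (\<beta> + real n + 2)
         / (pochhammer ((\<alpha> + \<beta> + 1) / 2) (n + 1)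
            * barnes_G (\<alpha> + \<beta> + 1) * barnes_G (\<alpha> + 1) * barnes_G (\<beta> + 1)))"
  proof -
    have "(\<alpha> + \<beta> + 1) / 2 + real (n + 1) = (\<alpha> + \<beta> + 3) / 2 + real n"
      "(\<alpha> + \<beta> + 2) / 2 + real (n + 1) = (\<alpha> + \<beta> + 4) / 2 + real n"
      "1 + real (n + 1) = real n + 2" "\<alpha> + \<beta> + 1 + real (n + 1) = \<alpha> + \<beta> + real n + 2"
      "\<alpha> + 1 + real (n + 1) = \<alpha> + real n + 2" "\<beta> + 1 + real (n + 1) = \<beta> + real n + 2"
      "2 * \<alpha> + 2 * \<beta> + real (n + 1) = 2 * \<alpha> + 2 * \<beta> + real n + 1"
      by (simp_all add: field_simps)
    thus ?thesis
      unfolding hankel_closed_form_def[OF params] by (simp only:)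
  qed
  finally show ?thesis
    using AB BA carrier by (simp add: inverts_mat_def)
qed

end
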